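(* There is an algorithm that, given a strongly connected weighted digraph $G=(V,E,w)$ with $n$ vertices, $m$ edges, unweighted diameter $d$ and weights in $[-w_{\max},w_{\max}]$, and $\tilde\varepsilon>0$, finds an $\tilde\varepsilon$-suboptimal solution $P\in\Delta_E$ of $$\min_{P\in\Delta_E}\ \langle P,W\rangle+3dw_{\max}\|P\mathbf{1}-P^T\mathbf{1}\|_1$$ in $\tilde O(m d w_{\max}/\tilde\varepsilon)$ time.
   Context: Vertices are identified with $[n]$. $W_{ij}=w(i,j)$ for $(i,j)\in E$, $\langle P,W\rangle=\sum_{(i,j)\in E}P_{ij}W_{ij}$, $\Delta_E=\{P\in\mathbb{R}_{\ge0}^{n\times n}:\sum_{ij}P_{ij}=1,\ \mathrm{supp}(P)\subseteq E\}$, $\mathbf{1}$ is the all-ones vector. $d$ is the maximum over ordered vertex pairs of the number of edges on a shortest directed path. $\tilde O(\cdot)$ suppresses polylogarithmic factors in $n$, $1/\tilde\varepsilon$ and $w_{\max}$. *)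

theory Defs
  imports Complex_Main
begin

section \<open>The machine model\<close>

text \<open>
  Running time is counted on a real RAM, given as a small imperative language.  The memory consists
  of named arrays, indexed by natural numbers, of natural numbers and of real numbers; a scalar
  variable is cell 0 of an array.  A program mentions only finitely many array names, so interleaving
  the arrays gives an ordinary RAM with one integer and one real address space.

  Every operation costs one unit.  The integer part has only addition, truncated subtraction,
  comparison and indirect addressing (the instruction set of Cook and Reckhow): there is no integer
  multiplication.  The real part has the four field operations and exact comparison, as in the
  Blum--Shub--Smale model: there is neither rounding to an integer nor any transcendental function,
  and the only constants are natural numbers.
\<close>

type_synonym state = "(string \<Rightarrow> nat \<Rightarrow> nat) \<times> (string \<Rightarrow> nat \<Rightarrow> real)"

datatype nexp =
    NConst nat
  | NGet string nexp
  | NAdd nexp nexp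
  | NSub nexp nexp

datatype rexp =
    ROfNat nexp
  | RGet string nexp
  | RAdd rexp rexp
  | RSub rexp rexp
  | RMul rexp rexp
  | RDiv rexp rexp

datatype bexp =
    NLess nexp nexp
  | RLess rexp rexp
  | BNot bexp
  | BAnd bexp bexp

datatype com =
    Skip
  | NStore string nexp nexp
  | RStore string nexp rexp
  | Seq com com
  | Cond bexp com com
  | While bexp com

fun nval :: "nexp \<Rightarrow> state \<Rightarrow> nat" where
  "nval (NConst k) s = k"
| "nval (NGet a i) s = fst s a (nval i s)"
| "nval (NAdd e f) s = nval e s + nval f s"
| "nval (NSub e f) s = nval e s - nval f s"

fun rval :: "rexp \<Rightarrow> state \<Rightarrow> real" where
  "rval (ROfNat e) s = real (nval e s)"
| "rval (RGet a i) s = snd s a (nval i s)"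
| "rval (RAdd e f) s = rval e s + rval f s"
| "rval (RSub e f) s = rval e s - rval f s"
| "rval (RMul e f) s = rval e s * rval f s"
| "rval (RDiv e f) s = rval e s / rval f s"

fun bval :: "bexp \<Rightarrow> state \<Rightarrow> bool" where
  "bval (NLess e f) s \<longleftrightarrow> nval e s < nval f s"
| "bval (RLess e f) s \<longleftrightarrow> rval e s < rval f s"
| "bval (BNot b) s \<longleftrightarrow> \<not> bval b s"
| "bval (BAnd b c) s \<longleftrightarrow> bval b s \<and> bval c s"

fun ncost :: "nexp \<Rightarrow> nat" where
  "ncost (NConst k) = 1"
| "ncost (NGet a i) = 1 + ncost i"
| "ncost (NAdd e f) = 1 + ncost e + ncost f"
| "ncost (NSub e f) = 1 + ncost e + ncost f"

fun rcost :: "rexp \<Rightarrow> nat" where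
  "rcost (ROfNat e) = 1 + ncost e"
| "rcost (RGet a i) = 1 + ncost i"
| "rcost (RAdd e f) = 1 + rcost e + rcost f"
| "rcost (RSub e f) = 1 + rcost e + rcost f"
| "rcost (RMul e f) = 1 + rcost e + rcost f"
| "rcost (RDiv e f) = 1 + rcost e + rcost f"

fun bcost :: "bexp \<Rightarrow> nat" where
  "bcost (NLess e f) = 1 + ncost e + ncost f"
| "bcost (RLess e f) = 1 + rcost e + rcost f"
| "bcost (BNot b) = 1 + bcost b"
| "bcost (BAnd b c) = 1 + bcost b + bcost c"

definition nupd :: "string \<Rightarrow> nat \<Rightarrow> nat \<Rightarrow> state \<Rightarrow> state" where
  "nupd a i x s = ((fst s)(a := (fst s a)(i := x)), snd s)"

definition rupd :: "string \<Rightarrow> nat \<Rightarrow> real \<Rightarrow> state \<Rightarrow> state" where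
  "rupd a i x s = (fst s, (snd s)(a := (snd s a)(i := x)))"

text \<open>\<open>runs c s t s'\<close>: started in \<open>s\<close>, the program \<open>c\<close> halts in \<open>s'\<close> after exactly \<open>t\<close> operations.\<close>

inductive runs :: "com \<Rightarrow> state \<Rightarrow> nat \<Rightarrow> state \<Rightarrow> bool" where
  Skip: "runs Skip s 1 s"
| NStore: "runs (NStore a i e) s (1 + ncost i + ncost e) (nupd a (nval i s) (nval e s) s)"
| RStore: "runs (RStore a i e) s (1 + ncost i + rcost e) (rupd a (nval i s) (rval e s) s)"
| Seq: "runs c s t s' \<Longrightarrow> runs d s' u s'' \<Longrightarrow> runs (Seq c d) s (t + u) s''"
| CondTrue: "bval b s \<Longrightarrow> runs c s t s' \<Longrightarrow> runs (Cond b c d) s (1 + bcost b + t) s'"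
| CondFalse: "\<not> bval b s \<Longrightarrow> runs d s t s' \<Longrightarrow> runs (Cond b c d) s (1 + bcost b + t) s'"
| WhileFalse: "\<not> bval b s \<Longrightarrow> runs (While b c) s (1 + bcost b) s"
| WhileTrue: "bval b s \<Longrightarrow> runs c s t s' \<Longrightarrow> runs (While b c) s' u s'' \<Longrightarrow>
    runs (While b c) s (1 + bcost b + t + u) s''"

inductive_cases Skip_runsE: "runs Skip s t s'"
inductive_cases NStore_runsE: "runs (NStore a i e) s t s'"
inductive_cases RStore_runsE: "runs (RStore a i e) s t s'"
inductive_cases Seq_runsE: "runs (Seq c d) s t s'"
inductive_cases Cond_runsE: "runs (Cond b c d) s t s'"
inductive_cases While_runsE: "runs (While b c) s t s'"

lemma runs_deterministic:
  "runs c s t s' \<Longrightarrow> runs c s u s'' \<Longrightarrow> u = t \<and> s'' = s'"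
proof (induction arbitrary: u s'' rule: runs.induct)
  case (Skip s)
  then show ?case by (rule Skip_runsE) simp
next
  case (NStore a i e s)
  then show ?case by (rule NStore_runsE) simp
next
  case (RStore a i e s)
  then show ?case by (rule RStore_runsE) simp
next
  case (Seq c s t s' d u' s2)
  from Seq.prems obtain t1 s1 u1
    where u: "u = t1 + u1" and 1: "runs c s t1 s1" and 2: "runs d s1 u1 s''"
    by (rule Seq_runsE)
  from Seq.IH(1)[OF 1] 2 have "t1 = t" "runs d s' u1 s''" by simp_all
  with Seq.IH(2) u show ?case by simp
next
  case (CondTrue b s c t s' d)
  from CondTrue.prems obtain t1 where "u = 1 + bcost b + t1" "runs c s t1 s''"
    by (rule Cond_runsE) (use CondTrue.hyps in simp_all)
  with CondTrue.IH show ?case by simp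
next
  case (CondFalse b s d t s' c)
  from CondFalse.prems obtain t1 where "u = 1 + bcost b + t1" "runs d s t1 s''"
    by (rule Cond_runsE) (use CondFalse.hyps in simp_all)
  with CondFalse.IH show ?case by simp
next
  case (WhileFalse b s c)
  from WhileFalse.prems show ?case by (rule While_runsE) (use WhileFalse.hyps in simp_all)
next
  case (WhileTrue b s c t s' u' s2)
  from WhileTrue.prems obtain t1 s1 u1
    where u: "u = 1 + bcost b + t1 + u1" and 1: "runs c s t1 s1"
      and 2: "runs (While b c) s1 u1 s''"
    by (rule While_runsE) (use WhileTrue.hyps in simp_all)
  from WhileTrue.IH(1)[OF 1] 2 have "t1 = t" "runs (While b c) s' u1 s''" by simp_all
  with WhileTrue.IH(2) u show ?case by simp
qed


section \<open>Digraphs\<close>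

text \<open>
  The vertex set is \<open>{..<n}\<close>, the edge set is a set of ordered pairs; self-loops are allowed.
\<close>

definition strongly_connected :: "nat \<Rightarrow> (nat \<times> nat) set \<Rightarrow> bool" where
  "strongly_connected n E \<longleftrightarrow> (\<forall>u<n. \<forall>v<n. (u, v) \<in> E\<^sup>*)"

definition hop_dist :: "(nat \<times> nat) set \<Rightarrow> nat \<Rightarrow> nat \<Rightarrow> nat" where
  "hop_dist E u v = (LEAST k. (u, v) \<in> E ^^ k)"

definition hop_diameter :: "nat \<Rightarrow> (nat \<times> nat) set \<Rightarrow> nat" where
  "hop_diameter n E = Max {hop_dist E u v | u v. u < n \<and> v < n}"


section \<open>The optimization problem\<close>

text \<open>
  An \<open>n \<times> n\<close> matrix is a function of two natural numbers; entries with an index outside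
  \<open>{..<n}\<close> are not in the support of a member of \<open>edge_simplex n E\<close>, hence 0.
\<close>

definition edge_simplex :: "nat \<Rightarrow> (nat \<times> nat) set \<Rightarrow> (nat \<Rightarrow> nat \<Rightarrow> real) set" where
  "edge_simplex n E = {P. (\<forall>i j. 0 \<le> P i j) \<and> (\<Sum>i<n. \<Sum>j<n. P i j) = 1 \<and>
     (\<forall>i j. P i j \<noteq> 0 \<longrightarrow> (i, j) \<in> E)}"

definition edge_inner ::
  "(nat \<times> nat) set \<Rightarrow> (nat \<Rightarrow> nat \<Rightarrow> real) \<Rightarrow> (nat \<Rightarrow> nat \<Rightarrow> real) \<Rightarrow> real" where
  "edge_inner E P W = (\<Sum>(i, j)\<in>E. P i j * W i j)"

text \<open>The norm \<open>\<parallel>P1 - P\<^sup>T1\<parallel>\<^sub>1\<close>, where \<open>1\<close> is the all-ones vector.\<close>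

definition imbalance :: "nat \<Rightarrow> (nat \<Rightarrow> nat \<Rightarrow> real) \<Rightarrow> real" where
  "imbalance n P = (\<Sum>i<n. \<bar>(\<Sum>j<n. P i j) - (\<Sum>j<n. P j i)\<bar>)"

definition penalized_objective ::
  "nat \<Rightarrow> (nat \<times> nat) set \<Rightarrow> (nat \<Rightarrow> nat \<Rightarrow> real) \<Rightarrow> real \<Rightarrow> (nat \<Rightarrow> nat \<Rightarrow> real) \<Rightarrow> real" where
  "penalized_objective n E w wmax P =
     edge_inner E P w + 3 * real (hop_diameter n E) * wmax * imbalance n P"

definition suboptimal_on :: "real \<Rightarrow> 'a set \<Rightarrow> ('a \<Rightarrow> real) \<Rightarrow> 'a \<Rightarrow> bool" where
  "suboptimal_on \<epsilon> S f x \<longleftrightarrow> x \<in> S \<and> (\<forall>y\<in>S. f x \<le> f y + \<epsilon>)"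


section \<open>Input and output\<close>

text \<open>
  The digraph is presented by adjacency lists, stored contiguously: the edges with tail \<open>v\<close> occupy
  the positions \<open>k\<close> from \<open>off[v]\<close> up to but excluding \<open>off[v + 1]\<close>, in any order, with head
  \<open>tgt[k]\<close> and weight \<open>wt[k]\<close>.  The other inputs are \<open>n\<close>, the number of edges, \<open>wmax\<close> and \<open>eps\<close>.
  The diameter is not supplied.  All remaining cells are initially 0.
\<close>

definition input_state ::
  "nat \<Rightarrow> (nat \<times> nat) set \<Rightarrow> (nat \<Rightarrow> nat \<Rightarrow> real) \<Rightarrow> real \<Rightarrow> real \<Rightarrow> state \<Rightarrow> bool" where
  "input_state n E w wmax \<epsilon> s \<longleftrightarrow>
     fst s ''n'' 0 = n \<and> fst s ''m'' 0 = card E \<and>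
     snd s ''wmax'' 0 = wmax \<and> snd s ''eps'' 0 = \<epsilon> \<and>
     fst s ''off'' 0 = 0 \<and> fst s ''off'' n = card E \<and>
     (\<forall>v<n. fst s ''off'' v \<le> fst s ''off'' (Suc v) \<and>
        bij_betw (fst s ''tgt'') {fst s ''off'' v..<fst s ''off'' (Suc v)} {u. (v, u) \<in> E} \<and>
        (\<forall>k\<in>{fst s ''off'' v..<fst s ''off'' (Suc v)}. snd s ''wt'' k = w v (fst s ''tgt'' k))) \<and>
     (\<forall>a i. fst s a i \<noteq> 0 \<longrightarrow>
        (a = ''n'' \<and> i = 0) \<or> (a = ''m'' \<and> i = 0) \<or>
        (a = ''off'' \<and> i \<le> n) \<or> (a = ''tgt'' \<and> i < card E)) \<and>
     (\<forall>a i. snd s a i \<noteq> 0 \<longrightarrow>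
        (a = ''wmax'' \<and> i = 0) \<or> (a = ''eps'' \<and> i = 0) \<or> (a = ''wt'' \<and> i < card E))"

text \<open>
  The entries of the output matrix are read from the real array \<open>P\<close> of the final state \<open>s'\<close>, in the
  order in which the edges are listed in the initial state \<open>s\<close>.  For members of \<open>edge_simplex n E\<close>
  this determines the whole matrix.
\<close>

definition output_matrix :: "nat \<Rightarrow> state \<Rightarrow> state \<Rightarrow> (nat \<Rightarrow> nat \<Rightarrow> real) \<Rightarrow> bool" where
  "output_matrix n s s' P \<longleftrightarrow>
     (\<forall>v<n. \<forall>k\<in>{fst s ''off'' v..<fst s ''off'' (Suc v)}. P v (fst s ''tgt'' k) = snd s' ''P'' k)"

end

theory Submission
  imports Defs
begin

text \<open>
  Value iteration does all the work.  Let \<open>V\<^sub>T(u)\<close> be the least weight of a \<open>T\<close>-edge walk from \<open>u\<close>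
  and \<open>M = min V\<^sub>T\<close>.  The empirical measure \<open>P\<close> of a walk attaining \<open>M\<close> has \<open>\<langle>P,W\<rangle> = M/T\<close>, and its
  imbalance is at most \<open>2/T\<close> because only the two ends of the walk are unbalanced.  Conversely
  \<open>M/T\<close> bounds the objective from below on the whole simplex: averaging the inequalities
  \<open>V\<^bsub>j+1\<^esub>(u) \<le> w(u,v) + V\<^sub>j(v)\<close> over \<open>j < T\<close> yields potentials \<open>p\<close> with
  \<open>w(u,v) \<ge> M/T + p(u) - p(v)\<close>, and \<open>p\<close> oscillates by at most \<open>2 d wmax\<close>, since two vertices are
  joined by at most \<open>d\<close> edges.  Hence \<open>T \<ge> 6 d wmax/\<epsilon>\<close> rounds of cost \<open>O(m)\<close> suffice, without any
  logarithmic factor.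

  Breadth-first search from vertex 0 in both directions finds \<open>r\<close> with \<open>r \<le> d \<le> 2 r\<close> in time
  \<open>O(m d)\<close>.  This is affordable only if \<open>wmax/\<epsilon>\<close> is bounded below; but if \<open>\<epsilon> \<ge> 4 wmax\<close>, the weights do not
  matter, and any walk with \<open>12 m wmax/\<epsilon>\<close> edges is good enough, as \<open>d \<le> m\<close>.
\<close>

section \<open>Weakest preconditions with running time\<close>

text \<open>Runs are deterministic, so the existence of one suitable run already is total
  correctness. The postcondition also sees the operation count, so correctness and running time are
  proved together.\<close>

definition wp :: "com \<Rightarrow> state \<Rightarrow> (nat \<Rightarrow> state \<Rightarrow> bool) \<Rightarrow> bool" where
  "wp c s Q \<longleftrightarrow> (\<exists>t s'. runs c s t s' \<and> Q t s')"

lemma wp_mono: "wp c s Q \<Longrightarrow> (\<And>t s'. Q t s' \<Longrightarrow> R t s') \<Longrightarrow> wp c s R"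
  unfolding wp_def by blast

lemma runs_iff:
  "runs Skip s t s' \<longleftrightarrow> t = 1 \<and> s' = s"
  "runs (NStore a i e) s t s' \<longleftrightarrow> t = 1 + ncost i + ncost e \<and> s' = nupd a (nval i s) (nval e s) s"
  "runs (RStore a i f) s t s' \<longleftrightarrow> t = 1 + ncost i + rcost f \<and> s' = rupd a (nval i s) (rval f s) s"
  by (metis Skip_runsE runs.Skip, metis NStore_runsE runs.NStore, metis RStore_runsE runs.RStore)

lemma wp_Skip [simp]: "wp Skip s Q \<longleftrightarrow> Q 1 s"
  and wp_NStore [simp]:
    "wp (NStore a i e) s Q \<longleftrightarrow> Q (1 + ncost i + ncost e) (nupd a (nval i s) (nval e s) s)"
  and wp_RStore [simp]:
    "wp (RStore a i f) s Q \<longleftrightarrow> Q (1 + ncost i + rcost f) (rupd a (nval i s) (rval f s) s)"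
  unfolding wp_def runs_iff by blast+

lemma wp_Seq [simp]:
  "wp (Seq c d) s Q \<longleftrightarrow> wp c s (\<lambda>t s'. wp d s' (\<lambda>u. Q (t + u)))"
  unfolding wp_def by (blast elim: Seq_runsE intro: runs.Seq)

lemma runs_Cond_iff:
  "runs (Cond b c d) s t s' \<longleftrightarrow> (\<exists>u. t = 1 + bcost b + u \<and> runs (if bval b s then c else d) s u s')"
proof
  assume "runs (Cond b c d) s t s'"
  then show "\<exists>u. t = 1 + bcost b + u \<and> runs (if bval b s then c else d) s u s'"
    by (rule Cond_runsE) auto
next
  assume "\<exists>u. t = 1 + bcost b + u \<and> runs (if bval b s then c else d) s u s'"
  then obtain u where u: "t = 1 + bcost b + u" "runs (if bval b s then c else d) s u s'" by blast
  with runs.CondTrue[of b s c u s' d] runs.CondFalse[of b s d u s' c]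
  show "runs (Cond b c d) s t s'" by (cases "bval b s") simp_all
qed

lemma wp_Cond [simp]:
  "wp (Cond b c d) s Q \<longleftrightarrow>
     (if bval b s then wp c s (\<lambda>t. Q (1 + bcost b + t)) else wp d s (\<lambda>t. Q (1 + bcost b + t)))"
  unfolding wp_def runs_Cond_iff by (cases "bval b s") (simp_all only: if_True if_False, blast+)

text \<open>Every iteration lowers the variant \<open>\<mu>\<close>, so its initial value bounds the
  number of iterations, each costing at most \<open>K\<close> and one test; the remaining
  \<open>1 + bcost b\<close> is the final failing test.\<close>

lemma wp_While:
  assumes step: "\<And>s. I s \<Longrightarrow> bval b s \<Longrightarrow> wp c s (\<lambda>t s'. t \<le> K \<and> I s' \<and> \<mu> s' < (\<mu> s :: nat))"
    and "I s"
    and post: "\<And>t s'. t \<le> \<mu> s * (K + 1 + bcost b) + 1 + bcost b \<Longrightarrow> I s' \<Longrightarrow> \<not> bval b s' \<Longrightarrow> Q t s'"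
  shows "wp (While b c) s Q"
proof -
  have "\<exists>t s'. runs (While b c) s t s' \<and> t \<le> \<mu> s * (K + 1 + bcost b) + 1 + bcost b \<and> I s' \<and> \<not> bval b s'"
    using \<open>I s\<close>
  proof (induction "\<mu> s" arbitrary: s rule: less_induct)
    case less
    show ?case
    proof (cases "bval b s")
      case False
      with less.prems show ?thesis by (fastforce intro: runs.WhileFalse)
    next
      case True
      from step[OF less.prems True] obtain t s1
        where 1: "runs c s t s1" "t \<le> K" "I s1" "\<mu> s1 < \<mu> s" by (auto simp: wp_def)
      from less.hyps[OF 1(4,3)] obtain u s2
        where 2: "runs (While b c) s1 u s2" "u \<le> \<mu> s1 * (K + 1 + bcost b) + 1 + bcost b"
          "I s2" "\<not> bval b s2" by blast
      \<comment> \<open>The drop of the variant pays for the iteration just made.\<close>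
      have "Suc (\<mu> s1) * (K + 1 + bcost b) \<le> \<mu> s * (K + 1 + bcost b)"
        using 1(4) by (intro mult_le_mono1) simp
      with 1 2 have "1 + bcost b + t + u \<le> \<mu> s * (K + 1 + bcost b) + 1 + bcost b" by simp
      with runs.WhileTrue[OF True 1(1) 2(1)] 2 show ?thesis by blast
    qed
  qed
  with post show ?thesis unfolding wp_def by blast
qed

lemma fst_nupd [simp]: "fst (nupd a i x s) b = (if b = a then (fst s a)(i := x) else fst s b)"
  and snd_nupd [simp]: "snd (nupd a i x s) = snd s"
  and fst_rupd [simp]: "fst (rupd a i y s) = fst s"
  and snd_rupd [simp]: "snd (rupd a i y s) b = (if b = a then (snd s a)(i := y) else snd s b)"
  by (simp_all add: nupd_def rupd_def)

text \<open>A frame condition for the natural-number arrays only; the real arrays are framed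
  separately, by equations on \<open>snd\<close>.\<close>

definition unchanged :: "string set \<Rightarrow> state \<Rightarrow> state \<Rightarrow> bool" where
  "unchanged X s s' \<longleftrightarrow> (\<forall>a. a \<notin> X \<longrightarrow> fst s' a = fst s a)"

lemma unchanged_simps [simp]:
  "unchanged X s s"
  "a \<in> X \<Longrightarrow> unchanged X s (nupd a i x s') \<longleftrightarrow> unchanged X s s'"
  "unchanged X s (rupd a i y s') \<longleftrightarrow> unchanged X s s'"
  by (auto simp: unchanged_def)

lemma unchangedD: "unchanged X s s' \<Longrightarrow> a \<notin> X \<Longrightarrow> fst s' a = fst s a"
  by (simp add: unchanged_def)

section \<open>Penalized circulations\<close>

text \<open>Nonemptiness of \<open>E\<close> excludes the graphs with at most one vertex and no
  edge, which are strongly connected but have an empty simplex.\<close>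

locale weighted_digraph =
  fixes n :: nat and E :: "(nat \<times> nat) set" and w :: "nat \<Rightarrow> nat \<Rightarrow> real" and wmax :: real
  assumes E_subset: "E \<subseteq> {..<n} \<times> {..<n}"
    and E_nonempty: "E \<noteq> {}"
    and strongly: "strongly_connected n E"
    and w_bounded: "(i, j) \<in> E \<Longrightarrow> \<bar>w i j\<bar> \<le> wmax"
begin

abbreviation "d \<equiv> hop_diameter n E"

lemma edge_lt: "(u, v) \<in> E \<Longrightarrow> u < n \<and> v < n"
  using E_subset by auto

lemma finite_E: "finite E"
  using E_subset by (rule finite_subset) simp

lemma n_pos: "0 < n"
  using E_nonempty edge_lt by fastforce

lemma wmax_nonneg: "0 \<le> wmax"
  using E_nonempty w_bounded by force

section \<open>Hop distances and the diameter\<close>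

lemma hop_dist_walk:
  assumes "u < n" "v < n"
  shows "(u, v) \<in> E ^^ hop_dist E u v"
proof -
  have "(u, v) \<in> E\<^sup>*" using strongly assms by (simp add: strongly_connected_def)
  then obtain k where "(u, v) \<in> E ^^ k" by (auto simp: rtrancl_power)
  then show ?thesis unfolding hop_dist_def by (rule LeastI)
qed

lemma hop_dist_image: "{hop_dist E u v | u v. u < n \<and> v < n} = (\<lambda>(u, v). hop_dist E u v) ` ({..<n} \<times> {..<n})"
  by auto

lemma hop_dist_le: "u < n \<Longrightarrow> v < n \<Longrightarrow> hop_dist E u v \<le> d"
  unfolding hop_diameter_def by (rule Max_ge) (auto simp: hop_dist_image)

lemma short_walk:
  assumes "u < n" "v < n"
  obtains k where "k \<le> d" "(u, v) \<in> E ^^ k"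
  using hop_dist_walk[OF assms] hop_dist_le[OF assms] by blast

lemma hop_diameter_le:
  assumes "\<And>u v. u < n \<Longrightarrow> v < n \<Longrightarrow> \<exists>k\<le>D. (u, v) \<in> E ^^ k"
  shows "d \<le> D"
proof -
  have "hop_dist E u v \<le> D" if "u < n" "v < n" for u v
  proof -
    obtain k where "k \<le> D" "(u, v) \<in> E ^^ k" using assms \<open>u < n\<close> \<open>v < n\<close> by blast
    then show ?thesis unfolding hop_dist_def by (metis Least_le order_trans)
  qed
  moreover have "{hop_dist E u v | u v. u < n \<and> v < n} \<noteq> {}" using n_pos by blast
  ultimately show ?thesis
    unfolding hop_diameter_def by (subst Max_le_iff) (auto simp: hop_dist_image)
qed

lemma hop_diameter_pos:
  assumes "1 < n"
  shows "0 < d"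
proof (rule ccontr)
  assume "\<not> 0 < d"
  then have "hop_dist E 0 1 = 0" using hop_dist_le[of 0 1] assms by simp
  then show False using hop_dist_walk[of 0 1] assms by simp
qed

text \<open>Repetitions can be cut out of a walk, so connectivity alone joins any two vertices by at
  most \<open>card E\<close> edges. This replaces the unknown diameter where no search is
  run.\<close>

lemma hop_diameter_le_card: "d \<le> card E"
proof (rule hop_diameter_le)
  fix u v assume uv: "u < n" "v < n"
  from strongly uv obtain k where k: "(u, v) \<in> E ^^ k"
    by (auto simp: strongly_connected_def rtrancl_power)
  then show "\<exists>k\<le>card E. (u, v) \<in> E ^^ k"
    using relpow_finite_bounded[OF finite_E, of k] by blast
qed

lemma out_edge:
  assumes "u < n"
  obtains v where "(u, v) \<in> E"
proof (cases "\<exists>v<n. v \<noteq> u")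
  case True
  then obtain v where "v < n" "v \<noteq> u" by blast
  then have "(u, v) \<in> E\<^sup>*" using strongly assms by (simp add: strongly_connected_def)
  with \<open>v \<noteq> u\<close> that show ?thesis by (metis converse_rtranclE)
next
  \<comment> \<open>\<open>u\<close> is then the only vertex, so any edge is a loop at
    \<open>u\<close>.\<close>
  case False
  with E_nonempty edge_lt that show ?thesis by (metis ex_in_conv prod.exhaust)
qed

section \<open>Sums over the simplex and a crude lower bound\<close>

lemma objective_ge_inner: "edge_inner E P w \<le> penalized_objective n E w wmax P"
  unfolding penalized_objective_def imbalance_def
  using wmax_nonneg by (simp add: sum_nonneg)

lemma simplex_nonneg: "P \<in> edge_simplex n E \<Longrightarrow> 0 \<le> P i j"
  and simplex_support: "P \<in> edge_simplex n E \<Longrightarrow> (i, j) \<notin> E \<Longrightarrow> P i j = 0"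
  and simplex_total: "P \<in> edge_simplex n E \<Longrightarrow> (\<Sum>i<n. \<Sum>j<n. P i j) = 1"
  by (auto simp: edge_simplex_def)

lemma sum_over_edges:
  assumes "P \<in> edge_simplex n E"
  shows "(\<Sum>(i, j)\<in>E. P i j * f i j) = (\<Sum>i<n. \<Sum>j<n. P i j * f i j)"
proof -
  have "(\<Sum>(i, j)\<in>E. P i j * f i j) = (\<Sum>(i, j)\<in>{..<n} \<times> {..<n}. P i j * f i j)"
    by (rule sum.mono_neutral_left) (use E_subset simplex_support[OF assms] in auto)
  then show ?thesis by (simp add: sum.cartesian_product)
qed

text \<open>The inner product averages the weights under a probability measure, and the penalty is
  nonnegative.\<close>

lemma objective_ge_neg_wmax:
  assumes "P \<in> edge_simplex n E"
  shows "- wmax \<le> penalized_objective n E w wmax P"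
proof -
  have "- wmax = (\<Sum>i<n. \<Sum>j<n. P i j * - wmax)"
    using assms by (simp add: edge_simplex_def sum_negf flip: sum_distrib_right)
  also have "\<dots> = (\<Sum>(i, j)\<in>E. P i j * - wmax)"
    by (rule sum_over_edges[OF assms, symmetric])
  also have "\<dots> \<le> edge_inner E P w"
    unfolding edge_inner_def
    by (rule sum_mono)
      (use w_bounded simplex_nonneg[OF assms] in \<open>clarsimp simp del: mult_minus_right, intro mult_left_mono, fastforce+\<close>)
  finally show ?thesis using objective_ge_inner[of P] by simp
qed

end

section \<open>Value functions and the lower bound they certify\<close>

text \<open>\<open>V_le\<close> and \<open>V_attained\<close> together form the Bellman recursion
  for cheapest walks of fixed length. Splitting the minimum in two matches what the computed table
  provides.\<close>

locale value_iteration = weighted_digraph +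
  fixes V :: "nat \<Rightarrow> nat \<Rightarrow> real" and T :: nat
  assumes V_0: "u < n \<Longrightarrow> V 0 u = 0"
    and V_le: "j < T \<Longrightarrow> (u, v) \<in> E \<Longrightarrow> V (Suc j) u \<le> w u v + V j v"
    and V_attained: "j < T \<Longrightarrow> u < n \<Longrightarrow> \<exists>v. (u, v) \<in> E \<and> V (Suc j) u = w u v + V j v"
begin

lemma V_bounded: "j \<le> T \<Longrightarrow> u < n \<Longrightarrow> \<bar>V j u\<bar> \<le> real j * wmax"
proof (induction j arbitrary: u)
  case 0
  then show ?case by (simp add: V_0)
next
  case (Suc j)
  then obtain v where v: "(u, v) \<in> E" "V (Suc j) u = w u v + V j v" using V_attained[of j u] by auto
  have "\<bar>V j v\<bar> \<le> real j * wmax" using Suc edge_lt[OF v(1)] by simp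
  with v w_bounded[OF v(1)] show ?case by (simp add: algebra_simps)
qed

lemma V_Suc_ge: "j < T \<Longrightarrow> u < n \<Longrightarrow> V j u \<le> V (Suc j) u + wmax"
proof (induction j arbitrary: u)
  case 0
  then show ?case using V_bounded[of 1 u] V_0[of u] by simp
next
  case (Suc j)
  then obtain v where v: "(u, v) \<in> E" "V (Suc (Suc j)) u = w u v + V (Suc j) v"
    using V_attained[of "Suc j" u] by auto
  have "V j v \<le> V (Suc j) v + wmax" using Suc edge_lt[OF v(1)] by simp
  with v V_le[of j u v] Suc.prems show ?case by simp
qed

lemma V_add_ge: "j + h \<le> T \<Longrightarrow> u < n \<Longrightarrow> V j u \<le> V (j + h) u + real h * wmax"
proof (induction h)
  case (Suc h)
  then show ?case using V_Suc_ge[of "j + h" u] by (simp add: algebra_simps)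
qed simp

lemma V_walk_le:
  "j + h \<le> T \<Longrightarrow> (u, v) \<in> E ^^ h \<Longrightarrow> V (j + h) u \<le> V j v + real h * wmax"
proof (induction h arbitrary: u)
  case (Suc h)
  from relpow_Suc_D2[OF Suc.prems(2)] obtain u'
    where u': "(u, u') \<in> E" "(u', v) \<in> E ^^ h" by blast
  then have "V (j + h) u' \<le> V j v + real h * wmax" using Suc by simp
  with V_le[of "j + h" u u'] w_bounded[of u u'] u' Suc.prems show ?case by (simp add: algebra_simps)
qed simp

text \<open>Go from \<open>u\<close> to \<open>v\<close> by \<open>h \<le> d\<close> edges, then
  follow a cheapest walk with \<open>j - h\<close> edges from \<open>v\<close>: the detour and the
  shortening each cost at most \<open>h * wmax\<close>. If \<open>j < h\<close>, both values are
  already at most \<open>j * wmax\<close> in modulus.\<close>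

lemma V_diff_le:
  assumes "j \<le> T" "u < n" "v < n"
  shows "V j u - V j v \<le> 2 * real d * wmax"
proof -
  obtain h where h: "h \<le> d" "(u, v) \<in> E ^^ h" using short_walk assms by blast
  have hd: "real h * wmax \<le> real d * wmax" using h wmax_nonneg by (simp add: mult_right_mono)
  show ?thesis
  proof (cases "h \<le> j")
    case True
    with V_walk_le[of "j - h" h u v] V_add_ge[of "j - h" h v] assms h hd show ?thesis by simp
  next
    case False
    then have "real j * wmax \<le> real h * wmax" using wmax_nonneg by (simp add: mult_right_mono)
    with V_bounded[of j u] V_bounded[of j v] assms hd show ?thesis by simp
  qed
qed

text \<open>Weak linear programming duality: the time average \<open>p\<close> of the value
  functions is a dual potential, under which every edge has reduced cost at least
  \<open>M / real T\<close>.\<close>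

lemma objective_ge_value:
  assumes P: "P \<in> edge_simplex n E" and "0 < T" and M: "\<And>u. u < n \<Longrightarrow> M \<le> V T u"
  shows "M / real T \<le> penalized_objective n E w wmax P"
proof -
  define p where "p u = (\<Sum>j<T. V j u) / real T" for u
  have edge: "M / real T + p u - p v \<le> w u v" if uv: "(u, v) \<in> E" for u v
  proof -
    have "(\<Sum>j<T. V (Suc j) u) \<le> (\<Sum>j<T. w u v + V j v)"
      by (rule sum_mono) (simp add: V_le uv)
    \<comment> \<open>Shifting the index changes the sum by \<open>V T u - V 0 u\<close>, and
      \<open>V 0 u\<close> is 0.\<close>
    moreover have "(\<Sum>j<T. V (Suc j) u) = (\<Sum>j<T. V j u) + V T u"
      using sum.lessThan_Suc_shift[of "\<lambda>j. V j u" T] V_0[of u] edge_lt[OF uv] by simp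
    moreover have "M \<le> V T u" using M edge_lt[OF uv] by simp
    ultimately have "M + (\<Sum>j<T. V j u) - (\<Sum>j<T. V j v) \<le> real T * w u v"
      by (simp add: sum.distrib)
    then have "(M + (\<Sum>j<T. V j u) - (\<Sum>j<T. V j v)) / real T \<le> w u v"
      using \<open>0 < T\<close> by (simp add: divide_le_eq mult.commute)
    then show ?thesis by (simp add: p_def add_divide_distrib diff_divide_distrib)
  qed
  have p_diff: "\<bar>p u - p 0\<bar> \<le> 2 * real d * wmax" if "u < n" for u
  proof -
    have "\<bar>(\<Sum>j<T. V j u) - (\<Sum>j<T. V j 0)\<bar> \<le> (\<Sum>j<T. \<bar>V j u - V j 0\<bar>)"
      by (simp flip: sum_subtractf)
    also have "\<dots> \<le> (\<Sum>j<T. 2 * real d * wmax)"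
      by (rule sum_mono) (use V_diff_le[of _ u 0] V_diff_le[of _ 0 u] that n_pos in \<open>force simp: abs_le_iff\<close>)
    finally show ?thesis
      using \<open>0 < T\<close> by (simp add: p_def field_simps flip: diff_divide_distrib)
  qed
  define out where "out u = (\<Sum>v<n. P u v)" for u
  define inn where "inn u = (\<Sum>v<n. P v u)" for u
  have tot: "(\<Sum>u<n. out u) = 1" "(\<Sum>u<n. inn u) = 1"
    using P sum.swap[of "\<lambda>u v. P u v" "{..<n}" "{..<n}"]
    by (simp_all add: out_def inn_def edge_simplex_def)
  have "(\<Sum>u<n. \<Sum>v<n. P u v * (p u - p v)) = (\<Sum>u<n. p u * out u) - (\<Sum>u<n. \<Sum>v<n. p v * P u v)"
    by (simp add: out_def sum_subtractf sum_distrib_left algebra_simps)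
  also have "(\<Sum>u<n. \<Sum>v<n. p v * P u v) = (\<Sum>v<n. p v * inn v)"
    by (subst sum.swap) (simp add: inn_def sum_distrib_left)
  \<comment> \<open>Subtracting the constant \<open>p 0\<close> is free because \<open>out\<close>
    and \<open>inn\<close> have the same total; after it, only the oscillation of \<open>p\<close>
    matters.\<close>
  also have "(\<Sum>u<n. p u * out u) - (\<Sum>v<n. p v * inn v) = (\<Sum>u<n. (p u - p 0) * (out u - inn u))"
    using tot by (simp add: algebra_simps sum_subtractf sum.distrib flip: sum_distrib_right)
  finally have pot: "(\<Sum>u<n. \<Sum>v<n. P u v * (p u - p v)) = (\<Sum>u<n. (p u - p 0) * (out u - inn u))" .
  have "\<bar>\<Sum>u<n. (p u - p 0) * (out u - inn u)\<bar> \<le> (\<Sum>u<n. \<bar>(p u - p 0) * (out u - inn u)\<bar>)"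
    by (rule sum_abs)
  also have "\<dots> \<le> (\<Sum>u<n. 2 * real d * wmax * \<bar>out u - inn u\<bar>)"
    by (rule sum_mono) (use p_diff in \<open>simp add: abs_mult mult_right_mono\<close>)
  also have "\<dots> = 2 * real d * wmax * imbalance n P"
    by (simp add: imbalance_def out_def inn_def sum_distrib_left)
  \<comment> \<open>The oscillation of \<open>p\<close> does not exceed the penalty coefficient, so
    the penalty outweighs whatever an unbalanced \<open>P\<close> gains from
    \<open>p\<close>.\<close>
  also have "\<dots> \<le> 3 * real d * wmax * imbalance n P"
    using wmax_nonneg by (intro mult_right_mono) (simp_all add: imbalance_def sum_nonneg)
  finally have imb: "- (3 * real d * wmax * imbalance n P) \<le> (\<Sum>u<n. \<Sum>v<n. P u v * (p u - p v))"
    unfolding pot by simp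
  have "M / real T + (\<Sum>u<n. \<Sum>v<n. P u v * (p u - p v))
      = (\<Sum>u<n. \<Sum>v<n. P u v * (M / real T + p u - p v))"
  proof -
    have "(\<Sum>u<n. \<Sum>v<n. P u v * (M / real T)) = M / real T"
      using simplex_total[OF P] by (simp only: mult_1_left flip: sum_distrib_right)
    then show ?thesis by (simp add: algebra_simps sum.distrib sum_subtractf)
  qed
  also have "\<dots> = (\<Sum>(u, v)\<in>E. P u v * (M / real T + p u - p v))"
    by (rule sum_over_edges[OF P, symmetric])
  also have "\<dots> \<le> edge_inner E P w"
    unfolding edge_inner_def
    by (rule sum_mono) (use P edge in \<open>force simp: edge_simplex_def intro!: mult_left_mono\<close>)
  finally show ?thesis using imb by (simp add: penalized_objective_def)
qed

end

section \<open>Empirical edge measures of walks\<close>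

definition walk_matrix :: "nat \<Rightarrow> (nat \<Rightarrow> nat) \<Rightarrow> nat \<Rightarrow> nat \<Rightarrow> real" where
  "walk_matrix T x u v = (\<Sum>t<T. of_bool (x t = u \<and> x (Suc t) = v)) / real T"

context weighted_digraph
begin

text \<open>Integration against the empirical measure is a time average. Taking \<open>f\<close>
  constant, an indicator or \<open>w\<close> gives the total mass, the marginals and the
  cost.\<close>

lemma walk_matrix_sum:
  assumes "\<And>t. t \<le> T \<Longrightarrow> x t < n"
  shows "(\<Sum>u<n. \<Sum>v<n. walk_matrix T x u v * f u v) = (\<Sum>t<T. f (x t) (x (Suc t))) / real T"
proof -
  have "(\<Sum>u<n. \<Sum>v<n. (\<Sum>t<T. of_bool (x t = u \<and> x (Suc t) = v) * f u v))
      = (\<Sum>t<T. \<Sum>u<n. \<Sum>v<n. of_bool (x t = u \<and> x (Suc t) = v) * f u v)"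
    by (subst (2) sum.swap, subst sum.swap) simp
  also have "\<dots> = (\<Sum>t<T. f (x t) (x (Suc t)))"
  proof (rule sum.cong)
    fix t assume "t \<in> {..<T}"
    then have "x t < n" "x (Suc t) < n" using assms by auto
    then show "(\<Sum>u<n. \<Sum>v<n. of_bool (x t = u \<and> x (Suc t) = v) * f u v) = f (x t) (x (Suc t))"
      by (simp add: of_bool_conj mult.assoc flip: sum_distrib_left)
  qed simp
  finally show ?thesis
    by (simp add: walk_matrix_def sum_distrib_right sum_divide_distrib flip: sum_divide_distrib)
qed

lemma walk_matrix_simplex:
  assumes "\<And>t. t < T \<Longrightarrow> (x t, x (Suc t)) \<in> E" "0 < T" "\<And>t. t \<le> T \<Longrightarrow> x t < n"
  shows "walk_matrix T x \<in> edge_simplex n E"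
proof -
  have "(i, j) \<in> E" if "walk_matrix T x i j \<noteq> 0" for i j
  proof -
    from that have "\<exists>t\<in>{..<T}. of_bool (x t = i \<and> x (Suc t) = j) \<noteq> (0::real)"
      unfolding walk_matrix_def by (metis (no_types, lifting) div_0 sum.neutral)
    then show ?thesis using assms(1) by auto
  qed
  moreover have "(\<Sum>i<n. \<Sum>j<n. walk_matrix T x i j) = 1"
    using walk_matrix_sum[of T x "\<lambda>_ _. 1"] assms by simp
  ultimately show ?thesis
    by (auto simp: edge_simplex_def walk_matrix_def sum_nonneg)
qed

text \<open>The two marginals count visits at the times \<open>0\<close> to \<open>T - 1\<close> and
  \<open>1\<close> to \<open>T\<close>; their difference telescopes to the two ends of the
  walk.\<close>

lemma walk_matrix_imbalance:
  assumes "\<And>t. t \<le> T \<Longrightarrow> x t < n"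
  shows "imbalance n (walk_matrix T x) \<le> 2 / real T"
proof -
  have row: "(\<Sum>j<n. walk_matrix T x i j) = (\<Sum>t<T. of_bool (x t = i)) / real T" if "i < n" for i
    using walk_matrix_sum[of T x "\<lambda>u _. of_bool (u = i)"] assms that
    by (simp flip: sum_distrib_right)
  have col: "(\<Sum>j<n. walk_matrix T x j i) = (\<Sum>t<T. of_bool (x (Suc t) = i)) / real T" if "i < n" for i
    using walk_matrix_sum[of T x "\<lambda>_ v. of_bool (v = i)"] assms that
    by simp
  have "(\<Sum>t<T. of_bool (x t = i)) - (\<Sum>t<T. of_bool (x (Suc t) = i)) = (of_bool (x 0 = i) - of_bool (x T = i) :: real)" for i
    using sum_lessThan_telescope'[of "\<lambda>t. of_bool (x t = i) :: real" T] by (simp add: sum_subtractf)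
  then have "imbalance n (walk_matrix T x) = (\<Sum>i<n. \<bar>of_bool (x 0 = i) - of_bool (x T = i)\<bar> / real T)"
    unfolding imbalance_def by (intro sum.cong) (simp_all add: row col flip: diff_divide_distrib)
  also have "\<dots> \<le> (\<Sum>i<n. (of_bool (x 0 = i) + of_bool (x T = i)) / real T)"
    by (intro sum_mono divide_right_mono) (auto simp: of_bool_def)
  also have "\<dots> = 2 / real T"
    using assms by (simp add: sum.distrib flip: sum_divide_distrib)
  finally show ?thesis .
qed

lemma walk_matrix_objective:
  assumes "\<And>t. t < T \<Longrightarrow> (x t, x (Suc t)) \<in> E" "0 < T" "\<And>t. t \<le> T \<Longrightarrow> x t < n"
  shows "penalized_objective n E w wmax (walk_matrix T x)
    \<le> (\<Sum>t<T. w (x t) (x (Suc t))) / real T + 6 * real d * wmax / real T"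
proof -
  have "edge_inner E (walk_matrix T x) w = (\<Sum>t<T. w (x t) (x (Suc t))) / real T"
    unfolding edge_inner_def
    using sum_over_edges[OF walk_matrix_simplex[of T x], of w] walk_matrix_sum[of T x w] assms by simp
  moreover have "3 * real d * wmax * imbalance n (walk_matrix T x) \<le> 3 * real d * wmax * (2 / real T)"
    using walk_matrix_imbalance[of T x] assms wmax_nonneg by (intro mult_left_mono) auto
  ultimately show ?thesis unfolding penalized_objective_def by simp
qed

end

section \<open>Adjacency lists\<close>

locale graph_input = weighted_digraph +
  fixes \<epsilon> :: real and s\<^sub>0 :: state
  assumes eps_pos: "0 < \<epsilon>"
    and input: "input_state n E w wmax \<epsilon> s\<^sub>0"
begin

abbreviation "m \<equiv> card E"
abbreviation "off \<equiv> fst s\<^sub>0 ''off''"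
abbreviation "tgt \<equiv> fst s\<^sub>0 ''tgt''"
abbreviation "wt \<equiv> snd s\<^sub>0 ''wt''"

text \<open>The tail of the edge stored at position \<open>k\<close>: offsets are nondecreasing, so
  the first row ending beyond \<open>k\<close> is the row containing \<open>k\<close>.\<close>

definition src :: "nat \<Rightarrow> nat" where
  "src k = (LEAST u. k < off (Suc u))"

lemma off_0: "off 0 = 0" and off_n: "off n = m"
  and off_Suc: "u < n \<Longrightarrow> off u \<le> off (Suc u)"
  and tgt_bij: "u < n \<Longrightarrow> bij_betw tgt {off u..<off (Suc u)} {v. (u, v) \<in> E}"
  and wt_eq: "u < n \<Longrightarrow> k \<in> {off u..<off (Suc u)} \<Longrightarrow> wt k = w u (tgt k)"
  using input unfolding input_state_def by blast+

lemma off_mono: "u \<le> v \<Longrightarrow> v \<le> n \<Longrightarrow> off u \<le> off v"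
proof (induction v rule: dec_induct)
  case (step v)
  then show ?case using off_Suc[of v] by simp
qed simp

lemma src_unique:
  assumes "u < n" "off u \<le> k" "k < off (Suc u)"
  shows "src k = u"
  unfolding src_def
proof (rule Least_equality)
  fix v assume v: "k < off (Suc v)"
  show "u \<le> v"
  proof (rule ccontr)
    assume "\<not> u \<le> v"
    then have "off (Suc v) \<le> off u" using assms(1) by (intro off_mono) auto
    with v assms(2) show False by simp
  qed
qed fact

lemma src_range:
  assumes "k < m"
  shows "src k < n" "off (src k) \<le> k" "k < off (Suc (src k))"
proof -
  have "k < off (Suc (n - 1))" using assms n_pos off_n by simp
  then have "src k \<le> n - 1" and less: "k < off (Suc (src k))"
    unfolding src_def by (rule Least_le, rule LeastI)
  then show "src k < n" "k < off (Suc (src k))" using n_pos by auto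
  show "off (src k) \<le> k"
  proof (cases "src k")
    case 0
    then show ?thesis by (simp add: off_0)
  next
    case (Suc u)
    then have "\<not> k < off (Suc u)" unfolding src_def by (intro not_less_Least) simp
    with Suc show ?thesis by simp
  qed
qed

lemma edge: "k < m \<Longrightarrow> (src k, tgt k) \<in> E"
  using tgt_bij[of "src k"] src_range[of k] by (fastforce dest: bij_betw_apply)

lemma tgt_less: "k < m \<Longrightarrow> tgt k < n"
  using edge edge_lt by blast

lemma wt_edge: "k < m \<Longrightarrow> wt k = w (src k) (tgt k)"
  using src_range wt_eq by simp

lemma edge_index:
  assumes "(u, v) \<in> E"
  obtains k where "k < m" "src k = u" "tgt k = v"
proof -
  have u: "u < n" using edge_lt assms by blast
  from tgt_bij[OF u] assms have "v \<in> tgt ` {off u..<off (Suc u)}" by (simp add: bij_betw_def)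
  then obtain k where k: "k \<in> {off u..<off (Suc u)}" "tgt k = v" by blast
  moreover have "off (Suc u) \<le> m" using off_mono[of "Suc u" n] u off_n by simp
  ultimately show ?thesis using src_unique[OF u] by (intro that[of k]) auto
qed

lemma edge_index_inj: "k < m \<Longrightarrow> l < m \<Longrightarrow> src k = src l \<Longrightarrow> tgt k = tgt l \<Longrightarrow> k = l"
  using tgt_bij[of "src k"] src_range[of k] src_range[of l]
  by (auto simp: bij_betw_def dest: inj_onD)

lemma E_eq: "E = {(src k, tgt k) | k. k < m}"
proof (intro equalityI subsetI)
  fix e assume "e \<in> E"
  then show "e \<in> {(src k, tgt k) | k. k < m}" using edge_index by (cases e) blast
qed (use edge in auto)

lemma edge_from:
  assumes "u < n"
  obtains k where "k < m" "src k = u"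
  using out_edge[OF assms] edge_index by metis

lemma m_pos: "0 < m"
  using E_nonempty finite_E by (simp add: card_gt_0_iff)

text \<open>Every vertex has an outgoing edge. Hence work linear in \<open>n\<close> counts as work
  linear in \<open>m\<close>.\<close>

lemma n_le_m: "n \<le> m"
proof -
  have "{..<n} \<subseteq> src ` {..<m}" using edge_from by blast
  from surj_card_le[OF _ this] show ?thesis by simp
qed

text \<open>No row is empty, so its first position holds an edge; this is the edge taken by the walk
  that ignores the weights.\<close>

lemma off_row: "u < n \<Longrightarrow> off u < m \<and> src (off u) = u"
proof -
  assume u: "u < n"
  then obtain k where "k < m" "src k = u" using edge_from by blast
  with src_range[of k] show ?thesis using src_unique[OF u, of "off u"] by auto
qed

definition loaded :: "state \<Rightarrow> bool" where
  "loaded s \<longleftrightarrow> fst s ''n'' 0 = n \<and> fst s ''m'' 0 = m \<and> fst s ''off'' = off \<and>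
     fst s ''tgt'' = tgt \<and> snd s ''wt'' = wt \<and> snd s ''wmax'' 0 = wmax \<and> snd s ''eps'' 0 = \<epsilon>"

lemma loaded_s0: "loaded s\<^sub>0"
  using input by (simp add: loaded_def input_state_def)

lemma blank:
  "a \<notin> {''n'', ''m'', ''off'', ''tgt''} \<Longrightarrow> fst s\<^sub>0 a = (\<lambda>_. 0)"
  "a \<notin> {''wmax'', ''eps'', ''wt''} \<Longrightarrow> snd s\<^sub>0 a = (\<lambda>_. 0)"
  using input unfolding input_state_def by (simp_all add: fun_eq_iff) blast+

lemma loaded_simps [simp]:
  "a \<notin> {''n'', ''m'', ''off'', ''tgt''} \<Longrightarrow> loaded (nupd a i x s) \<longleftrightarrow> loaded s"
  "a \<notin> {''wmax'', ''eps'', ''wt''} \<Longrightarrow> loaded (rupd a i y s) \<longleftrightarrow> loaded s"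
  "loaded s \<Longrightarrow> fst s ''n'' 0 = n" "loaded s \<Longrightarrow> fst s ''m'' 0 = m" "loaded s \<Longrightarrow> fst s ''off'' = off"
  "loaded s \<Longrightarrow> fst s ''tgt'' = tgt" "loaded s \<Longrightarrow> snd s ''wt'' = wt"
  "loaded s \<Longrightarrow> snd s ''wmax'' 0 = wmax" "loaded s \<Longrightarrow> snd s ''eps'' 0 = \<epsilon>"
  by (auto simp: loaded_def)

definition sourced :: "state \<Rightarrow> bool" where
  "sourced s \<longleftrightarrow> (\<forall>k<m. fst s ''src'' k = src k)"

lemma sourced_simps [simp]:
  "a \<noteq> ''src'' \<Longrightarrow> sourced (nupd a i x s) \<longleftrightarrow> sourced s"
  "sourced (rupd a i y s) \<longleftrightarrow> sourced s"
  "sourced s \<Longrightarrow> k < m \<Longrightarrow> fst s ''src'' k = src k"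
  by (auto simp: sourced_def)

end

abbreviation nvar :: "string \<Rightarrow> nexp" where "nvar x \<equiv> NGet x (NConst 0)"
abbreviation nset :: "string \<Rightarrow> nexp \<Rightarrow> com" where "nset x e \<equiv> NStore x (NConst 0) e"
abbreviation incr :: "string \<Rightarrow> com" where "incr x \<equiv> nset x (NAdd (nvar x) (NConst 1))"

text \<open>A merging sweep: each pass advances either the edge pointer or the row pointer, so
  linear time suffices. Later loops can then run over edge positions alone.\<close>

definition mark_sources :: com where
  "mark_sources =
     Seq (nset ''v'' (NConst 0)) (Seq (nset ''k'' (NConst 0))
       (While (NLess (nvar ''k'') (nvar ''m''))
         (Cond (NLess (nvar ''k'') (NGet ''off'' (NAdd (nvar ''v'') (NConst 1))))
           (Seq (NStore ''src'' (nvar ''k'') (nvar ''v'')) (incr ''k''))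
           (incr ''v''))))"

context graph_input
begin

lemma wp_mark_sources:
  assumes "loaded s"
    and post: "\<And>t s'. t \<le> 100 * m \<Longrightarrow> loaded s' \<Longrightarrow> sourced s' \<Longrightarrow>
      unchanged {''v'', ''k'', ''src''} s s' \<Longrightarrow> snd s' = snd s \<Longrightarrow> Q t s'"
  shows "wp mark_sources s Q"
  unfolding mark_sources_def
proof (simp, rule wp_While[where K = 30 and \<mu> = "\<lambda>s. (m - fst s ''k'' 0) + (n - fst s ''v'' 0)" and
    I = "\<lambda>s'. loaded s' \<and> unchanged {''v'', ''k'', ''src''} s s' \<and> snd s' = snd s \<and>
       fst s' ''v'' 0 \<le> n \<and> off (fst s' ''v'' 0) \<le> fst s' ''k'' 0 \<and> fst s' ''k'' 0 \<le> m \<and>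
       (\<forall>k<fst s' ''k'' 0. fst s' ''src'' k = src k)"], goal_cases)
  case (1 s')
  then have k: "fst s' ''k'' 0 < m" by simp
  \<comment> \<open>At \<open>v = n\<close> the invariant would give
    \<open>m = off n \<le> k\<close>.\<close>
  then have v: "fst s' ''v'' 0 < n" using 1 off_n by (cases "fst s' ''v'' 0 = n") auto
  from 1 k v src_unique[OF v, of "fst s' ''k'' 0"] show ?case
    by (simp add: less_Suc_eq diff_less_mono2)
next
  case 2
  then show ?case using assms(1) off_0 by simp
next
  case (3 t s')
  then show ?case using n_le_m m_pos by (intro post) (simp_all add: sourced_def)
qed

end

section \<open>Breadth-first search\<close>

text \<open>Search labels: 0 for an unreached vertex, one plus the distance from vertex 0 otherwise.\<close>

definition grow :: "nat \<Rightarrow> (nat \<Rightarrow> nat) \<Rightarrow> (nat \<Rightarrow> nat) \<Rightarrow> nat \<Rightarrow> (nat \<Rightarrow> nat) \<Rightarrow> nat \<Rightarrow> nat" where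
  "grow l p q k f v = (if f v = 0 \<and> (\<exists>i<k. q i = v \<and> 0 < f (p i)) then l else f v)"

lemma grow_0 [simp]: "grow l p q 0 f = f"
  by (simp add: grow_def fun_eq_iff)

text \<open>Label \<open>l\<close> marks vertices found in the current round. The test
  \<open>g (p k) < l\<close> stops them from spreading, so one sweep in place adds exactly one
  layer.\<close>

lemma grow_Suc:
  assumes "\<forall>v. f v < l" and "g = grow l p q k f"
  shows "grow l p q (Suc k) f =
    (if 0 < g (p k) \<and> g (p k) < l \<and> g (q k) = 0 then g(q k := l) else g)"
proof
  fix v
  show "grow l p q (Suc k) f v =
    (if 0 < g (p k) \<and> g (p k) < l \<and> g (q k) = 0 then g(q k := l) else g) v"
    using assms(1)[rule_format, of "p k"] assms(1)[rule_format, of v]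
    by (cases "q k = v") (auto simp: assms(2) grow_def less_Suc_eq)
qed

text \<open>The upper bound on the labels keeps \<open>j + 2\<close> fresh for the next
  round.\<close>

definition reaches :: "(nat \<times> nat) set \<Rightarrow> nat \<Rightarrow> (nat \<Rightarrow> nat) \<Rightarrow> bool" where
  "reaches R j f \<longleftrightarrow> (\<forall>v. f v < j + 2) \<and> (\<forall>v. 0 < f v \<longleftrightarrow> (\<exists>i\<le>j. (0, v) \<in> R ^^ i))"

lemma reaches_0: "reaches R 0 ((\<lambda>_. 0)(0 := 1))"
  by (auto simp: reaches_def)

lemma reaches_grow:
  assumes R: "R = {(p k, q k) | k. k < m}" and f: "reaches R j f"
  shows "reaches R (Suc j) (grow (j + 2) p q m f)"
proof -
  have "0 < grow (j + 2) p q m f v \<longleftrightarrow> (\<exists>i\<le>Suc j. (0, v) \<in> R ^^ i)" for v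
  proof -
    have "0 < grow (j + 2) p q m f v \<longleftrightarrow> 0 < f v \<or> (\<exists>u. (u, v) \<in> R \<and> 0 < f u)"
      by (auto simp: grow_def R)
    also have "\<dots> \<longleftrightarrow> (\<exists>i\<le>j. (0, v) \<in> R ^^ i) \<or> (\<exists>u. (u, v) \<in> R \<and> (\<exists>i\<le>j. (0, u) \<in> R ^^ i))"
      using f by (simp add: reaches_def)
    also have "\<dots> \<longleftrightarrow> (\<exists>i\<le>Suc j. (0, v) \<in> R ^^ i)"
    proof
      assume "(\<exists>i\<le>j. (0, v) \<in> R ^^ i) \<or> (\<exists>u. (u, v) \<in> R \<and> (\<exists>i\<le>j. (0, u) \<in> R ^^ i))"
      then show "\<exists>i\<le>Suc j. (0, v) \<in> R ^^ i"
      proof (elim disjE exE conjE)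
        fix i assume "i \<le> j" "(0, v) \<in> R ^^ i"
        then show ?thesis by (intro exI[of _ i]) simp
      next
        fix u i assume "(u, v) \<in> R" "i \<le> j" "(0, u) \<in> R ^^ i"
        then show ?thesis by (intro exI[of _ "Suc i"]) auto
      qed
    next
      assume "\<exists>i\<le>Suc j. (0, v) \<in> R ^^ i"
      then obtain i where i: "i \<le> Suc j" "(0, v) \<in> R ^^ i" by blast
      show "(\<exists>i\<le>j. (0, v) \<in> R ^^ i) \<or> (\<exists>u. (u, v) \<in> R \<and> (\<exists>i\<le>j. (0, u) \<in> R ^^ i))"
      proof (cases i)
        case 0
        then show ?thesis using i by blast
      next
        case (Suc i')
        with i obtain u where "(0, u) \<in> R ^^ i'" "(u, v) \<in> R" by (blast elim: relpow_Suc_E)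
        with i Suc show ?thesis by auto
      qed
    qed
    finally show ?thesis .
  qed
  moreover have "grow (j + 2) p q m f v < Suc j + 2" for v
    using f by (auto simp: grow_def reaches_def less_SucI)
  ultimately show ?thesis by (simp add: reaches_def)
qed

lemma relpow_converse:
  fixes R :: "('a \<times> 'a) set"
  shows "(u, v) \<in> (R\<inverse>) ^^ k \<longleftrightarrow> (v, u) \<in> R ^^ k"
proof (induction k arbitrary: v)
  case (Suc k)
  have "(u, v) \<in> (R\<inverse>) ^^ Suc k \<longleftrightarrow> (\<exists>y. (u, y) \<in> (R\<inverse>) ^^ k \<and> (v, y) \<in> R)" by auto
  also have "\<dots> \<longleftrightarrow> (v, u) \<in> R O R ^^ k" unfolding Suc by blast
  also have "R O R ^^ k = R ^^ Suc k" unfolding relpow_commute by simp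
  finally show ?case .
qed auto

section \<open>The search program\<close>

definition mark :: "string \<Rightarrow> string \<Rightarrow> string \<Rightarrow> com" where
  "mark a p q =
     Cond (BAnd (NLess (NConst 0) (NGet a (NGet p (nvar ''k''))))
          (BAnd (NLess (NGet a (NGet p (nvar ''k''))) (NAdd (nvar ''r'') (NConst 2)))
                (NLess (NGet a (NGet q (nvar ''k''))) (NConst 1))))
       (NStore a (NGet q (nvar ''k'')) (NAdd (nvar ''r'') (NConst 2))) Skip"

definition bfs_round :: com where
  "bfs_round =
     Seq (nset ''k'' (NConst 0))
       (While (NLess (nvar ''k'') (nvar ''m''))
         (Seq (mark ''fw'' ''src'' ''tgt'') (Seq (mark ''bw'' ''tgt'' ''src'') (incr ''k''))))"

definition bfs_check :: com where
  "bfs_check =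
     Seq (nset ''v'' (NConst 0))
       (While (BAnd (NLess (nvar ''v'') (nvar ''n''))
              (BAnd (NLess (NConst 0) (NGet ''fw'' (nvar ''v'')))
                    (NLess (NConst 0) (NGet ''bw'' (nvar ''v''))))) (incr ''v''))"

text \<open>\<open>v\<close> doubles as a flag: \<open>v < n\<close> means that the last check
  stopped at an unreached vertex \<open>v\<close>. At radius 0 only vertex 0 is reached, so
  \<open>v\<close> starts at 1.\<close>

definition bfs :: com where
  "bfs =
     Seq (NStore ''fw'' (NConst 0) (NConst 1)) (Seq (NStore ''bw'' (NConst 0) (NConst 1))
       (Seq (nset ''r'' (NConst 0)) (Seq (nset ''v'' (NConst 1))
         (While (NLess (nvar ''v'') (nvar ''n''))
           (Seq bfs_round (Seq (incr ''r'') bfs_check))))))"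

context graph_input
begin

lemma E_converse: "E\<inverse> = {(tgt k, src k) | k. k < m}"
  by (subst E_eq) auto

definition bfs_frame :: "state \<Rightarrow> state \<Rightarrow> bool" where
  "bfs_frame s s' \<longleftrightarrow> loaded s' \<and> sourced s' \<and>
     unchanged {''v'', ''k'', ''r'', ''fw'', ''bw''} s s' \<and> snd s' = snd s"

lemma bfs_frame_nupd:
  "a \<in> {''v'', ''k'', ''r'', ''fw'', ''bw''} \<Longrightarrow> bfs_frame s s' \<Longrightarrow> bfs_frame s (nupd a i x s')"
  by (auto simp: bfs_frame_def)

lemma bfs_frame_m: "bfs_frame s s' \<Longrightarrow> fst s' ''m'' 0 = m"
  and bfs_frame_n: "bfs_frame s s' \<Longrightarrow> fst s' ''n'' 0 = n"
  and bfs_frame_tgt: "bfs_frame s s' \<Longrightarrow> fst s' ''tgt'' = tgt"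
  and bfs_frame_src: "bfs_frame s s' \<Longrightarrow> k < m \<Longrightarrow> fst s' ''src'' k = src k"
  by (auto simp: bfs_frame_def)

lemma wp_bfs_round:
  assumes fr: "bfs_frame s0 s"
    and r: "\<forall>v. fst s ''fw'' v < fst s ''r'' 0 + 2" "\<forall>v. fst s ''bw'' v < fst s ''r'' 0 + 2"
    and post: "\<And>t s'. t \<le> 100 * m \<Longrightarrow> bfs_frame s0 s' \<Longrightarrow> fst s' ''r'' 0 = fst s ''r'' 0 \<Longrightarrow>
      fst s' ''fw'' = grow (fst s ''r'' 0 + 2) src tgt m (fst s ''fw'') \<Longrightarrow>
      fst s' ''bw'' = grow (fst s ''r'' 0 + 2) tgt src m (fst s ''bw'') \<Longrightarrow> Q t s'"
  shows "wp bfs_round s Q"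
  unfolding bfs_round_def
proof (simp, rule wp_While[where K = 80 and \<mu> = "\<lambda>s. m - fst s ''k'' 0" and
    I = "\<lambda>s'. bfs_frame s0 s' \<and> fst s' ''r'' 0 = fst s ''r'' 0 \<and> fst s' ''k'' 0 \<le> m \<and>
      fst s' ''fw'' = grow (fst s ''r'' 0 + 2) src tgt (fst s' ''k'' 0) (fst s ''fw'') \<and>
      fst s' ''bw'' = grow (fst s ''r'' 0 + 2) tgt src (fst s' ''k'' 0) (fst s ''bw'')"], goal_cases)
  case (1 s')
  define k where "k = fst s' ''k'' 0"
  from 1 have fr': "bfs_frame s0 s'" by simp
  with 1 have k: "k < m" by (simp add: k_def bfs_frame_m[OF fr'])
  note fw = grow_Suc[OF r(1), of "fst s' ''fw''" src tgt k]
  note bw = grow_Suc[OF r(2), of "fst s' ''bw''" tgt src k]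
  from 1 have fw': "fst s' ''fw'' = grow (fst s ''r'' 0 + 2) src tgt k (fst s ''fw'')"
    and bw': "fst s' ''bw'' = grow (fst s ''r'' 0 + 2) tgt src k (fst s ''bw'')"
    by (simp_all add: k_def)
  from 1 k fw[OF fw'] bw[OF bw'] show ?case
    by (simp add: mark_def bfs_frame_tgt[OF fr'] bfs_frame_src[OF fr'] bfs_frame_nupd
        diff_less_mono2 flip: k_def fw' bw')
next
  case 2
  then show ?case using fr by (simp add: bfs_frame_nupd)
next
  case (3 t s')
  then show ?case using m_pos bfs_frame_m[of s0 s'] by (intro post) auto
qed

lemma wp_bfs_check:
  assumes fr: "bfs_frame s0 s"
    and post: "\<And>t s'. t \<le> 100 * m \<Longrightarrow> bfs_frame s0 s' \<Longrightarrow>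
      unchanged {''v''} s s' \<Longrightarrow>
      (fst s' ''v'' 0 < n \<longleftrightarrow> (\<exists>v<n. fst s ''fw'' v = 0 \<or> fst s ''bw'' v = 0)) \<Longrightarrow> Q t s'"
  shows "wp bfs_check s Q"
  unfolding bfs_check_def
proof (simp, rule wp_While[where K = 20 and \<mu> = "\<lambda>s. n - fst s ''v'' 0" and
    I = "\<lambda>s'. bfs_frame s0 s' \<and> unchanged {''v''} s s' \<and> fst s' ''v'' 0 \<le> n \<and>
      (\<forall>v<fst s' ''v'' 0. 0 < fst s ''fw'' v \<and> 0 < fst s ''bw'' v)"], goal_cases)
  case (1 s')
  then have fr': "bfs_frame s0 s'" and un: "unchanged {''v''} s s'" by simp_all
  have "fst s' ''fw'' = fst s ''fw''" "fst s' ''bw'' = fst s ''bw''"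
    using unchangedD[OF un] by simp_all
  with 1 show ?case by (simp add: bfs_frame_n[OF fr'] bfs_frame_nupd less_Suc_eq diff_less_mono2)
next
  case 2
  then show ?case using fr by (simp add: bfs_frame_nupd)
next
  case (3 t s')
  then have fr': "bfs_frame s0 s'" and un: "unchanged {''v''} s s'" by simp_all
  have fw: "fst s' ''fw'' = fst s ''fw''" and bw: "fst s' ''bw'' = fst s ''bw''"
    using unchangedD[OF un] by simp_all
  have "fst s' ''v'' 0 < n \<longleftrightarrow> (\<exists>v<n. fst s ''fw'' v = 0 \<or> fst s ''bw'' v = 0)"
  proof (cases "fst s' ''v'' 0 < n")
    case True
    with 3 show ?thesis by (auto simp: bfs_frame_n[OF fr'] fw bw)
  next
    case False
    with 3 have "fst s' ''v'' 0 = n" by simp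
    with 3 show ?thesis by auto
  qed
  with 3 fr' un show ?case using n_le_m m_pos by (intro post) simp_all
qed

text \<open>A missing vertex has distance more than \<open>j\<close> from or to vertex 0. If none is
  missing, any two vertices are joined through vertex 0.\<close>

lemma all_reached_iff:
  assumes "reaches E j f" "reaches (E\<inverse>) j g"
  shows "(\<exists>v<n. f v = 0 \<or> g v = 0) \<Longrightarrow> j < d"
    and "\<not> (\<exists>v<n. f v = 0 \<or> g v = 0) \<Longrightarrow> d \<le> 2 * j"
proof -
  have f: "0 < f v \<longleftrightarrow> (\<exists>i\<le>j. (0, v) \<in> E ^^ i)" for v
    using assms(1) unfolding reaches_def by blast
  have g: "0 < g v \<longleftrightarrow> (\<exists>i\<le>j. (v, 0) \<in> E ^^ i)" for v
    using assms(2) unfolding reaches_def relpow_converse by blast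
  {
    assume "\<exists>v<n. f v = 0 \<or> g v = 0"
    then obtain v where v: "v < n" "f v = 0 \<or> g v = 0" by blast
    show "j < d"
    proof (rule ccontr)
      assume "\<not> j < d"
      then have le: "a \<le> j" if "a \<le> d" for a using that by simp
      have "0 < f v" unfolding f using short_walk[OF n_pos v(1)] le by blast
      moreover have "0 < g v" unfolding g using short_walk[OF v(1) n_pos] le by blast
      ultimately show False using v(2) by simp
    qed
  next
    assume all: "\<not> (\<exists>v<n. f v = 0 \<or> g v = 0)"
    show "d \<le> 2 * j"
    proof (rule hop_diameter_le)
      fix u v assume "u < n" "v < n"
      then have "0 < g u" "0 < f v" using all by auto
      then obtain a b where ab: "a \<le> j" "b \<le> j" and "(u, 0) \<in> E ^^ a" "(0, v) \<in> E ^^ b"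
        unfolding f g by blast
      then have "(u, v) \<in> E ^^ (a + b)" unfolding relpow_add by blast
      moreover have "a + b \<le> 2 * j" using ab by simp
      ultimately show "\<exists>k\<le>2 * j. (u, v) \<in> E ^^ k" by blast
    qed
  }
qed

lemma wp_bfs:
  assumes "loaded s" "sourced s" "fst s ''fw'' = (\<lambda>_. 0)" "fst s ''bw'' = (\<lambda>_. 0)"
    and post: "\<And>t s'. t \<le> 300 * m * (d + 1) \<Longrightarrow> bfs_frame s s' \<Longrightarrow>
      fst s' ''r'' 0 \<le> d \<Longrightarrow> d \<le> 2 * fst s' ''r'' 0 \<Longrightarrow> Q t s'"
  shows "wp bfs s Q"
  unfolding bfs_def
\<comment> \<open>The program does not know \<open>d\<close>, but it starts another round only after
  finding an unreached vertex, which certifies \<open>r < d\<close>.\<close>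
proof (simp, rule wp_While[where K = "200 * m + 10" and \<mu> = "\<lambda>s. d - fst s ''r'' 0" and
    I = "\<lambda>s'. bfs_frame s s' \<and> fst s' ''r'' 0 \<le> d \<and>
      reaches E (fst s' ''r'' 0) (fst s' ''fw'') \<and> reaches (E\<inverse>) (fst s' ''r'' 0) (fst s' ''bw'') \<and>
      (fst s' ''v'' 0 < n \<longrightarrow> fst s' ''r'' 0 < d) \<and>
      (\<not> fst s' ''v'' 0 < n \<longrightarrow> d \<le> 2 * fst s' ''r'' 0)"], goal_cases)
  case (1 s')
  from 1 have fr: "bfs_frame s s'" by simp
  with 1 have less: "fst s' ''r'' 0 < d" by (simp add: bfs_frame_n[OF fr])
  show ?case
  proof (simp, rule wp_bfs_round[OF fr], goal_cases)
    case (3 t1 s1)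
    have reach: "reaches E (Suc (fst s1 ''r'' 0)) (fst s1 ''fw'')"
      "reaches (E\<inverse>) (Suc (fst s1 ''r'' 0)) (fst s1 ''bw'')"
      using 1 3 reaches_grow[OF E_eq] reaches_grow[OF E_converse] by simp_all
    let ?s2 = "nupd ''r'' 0 (Suc (fst s1 ''r'' 0)) s1"
    have fr2: "bfs_frame s ?s2" using 3 by (simp add: bfs_frame_nupd)
    show ?case
    proof (rule wp_bfs_check[OF fr2], goal_cases)
      case (1 t2 s3)
      then have "fst s3 ''r'' 0 = Suc (fst s1 ''r'' 0)" "fst s3 ''fw'' = fst s1 ''fw''"
        "fst s3 ''bw'' = fst s1 ''bw''"
        by (simp_all add: unchangedD[of "{''v''}" ?s2])
      note eqs = this
      have r: "fst s1 ''r'' 0 = fst s' ''r'' 0" using 3 by simp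
      have t: "t1 + t2 \<le> 200 * m" using 1 3 by simp
      show ?case
      proof (cases "fst s3 ''v'' 0 < n")
        case True
        with 1(4) eqs have "Suc (fst s1 ''r'' 0) < d" by (intro all_reached_iff(1)[OF reach]) simp
        with True t 1(2) reach show ?thesis unfolding eqs r by simp
      next
        case False
        with 1(4) eqs have "d \<le> 2 * Suc (fst s1 ''r'' 0)" by (intro all_reached_iff(2)[OF reach]) simp
        with False less t 1(2) reach show ?thesis unfolding eqs r by simp
      qed
    qed
  qed (use 1 in \<open>auto simp: reaches_def\<close>)
next
  case 2
  have "bfs_frame s s" using assms by (simp add: bfs_frame_def)
  \<comment> \<open>With a single vertex the loop is skipped, and radius 0 is correct.\<close>
  moreover have "d \<le> 0" if "\<not> 1 < n"
    using that by (intro hop_diameter_le) (auto intro!: exI[of _ 0])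
  ultimately show ?case
    using assms reaches_0[of E] reaches_0[of "E\<inverse>"] hop_diameter_pos
    by (auto simp: bfs_frame_nupd)
next
  case (3 t s')
  have "d * (200 * m + 10 + 1 + 5) + 1 + 5 \<le> 220 * m * (d + 1)"
  proof -
    have "d * 20 \<le> m * (d * 20)" using m_pos by (cases m) auto
    then have "6 + d * 16 \<le> m * 220 + m * (d * 20)" using m_pos by linarith
    then show ?thesis by (simp add: algebra_simps)
  qed
  with 3 show ?case using m_pos bfs_frame_n[of s s'] by (intro post) auto
qed

end

section \<open>Value iteration\<close>

text \<open>Rows lie end to end and \<open>base\<close> advances by \<open>n\<close>, because the
  machine has no integer multiplication.\<close>

definition vi_round :: com where
  "vi_round =
     Seq (nset ''k'' (NConst 0))
    (Seq (nset ''next'' (NAdd (nvar ''base'') (nvar ''n'')))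
    (Seq (While (NLess (nvar ''k'') (nvar ''m''))
           (Seq (nset ''h'' (NAdd (nvar ''next'') (NGet ''src'' (nvar ''k''))))
           (Seq (RStore ''x'' (NConst 0) (RAdd (RGet ''wt'' (nvar ''k''))
                   (RGet ''G'' (NAdd (nvar ''base'') (NGet ''tgt'' (nvar ''k''))))))
           (Seq (Cond (BAnd (NLess (NConst 0) (NGet ''ch'' (nvar ''h'')))
                            (BNot (RLess (RGet ''x'' (NConst 0)) (RGet ''G'' (nvar ''h'')))))
                   Skip
                   (Seq (RStore ''G'' (nvar ''h'') (RGet ''x'' (NConst 0)))
                        (NStore ''ch'' (nvar ''h'') (NAdd (nvar ''k'') (NConst 1)))))
                (incr ''k'')))))
         (nset ''base'' (nvar ''next''))))"

text \<open>The summand \<open>eps\<close> in the loop condition forces at least one round, so that \<open>walk\<close> never divides by 0.\<close>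

definition repeat_rounds :: "com \<Rightarrow> com" where
  "repeat_rounds body =
     Seq (nset ''T'' (NConst 0))
       (While (RLess (RMul (ROfNat (nvar ''T'')) (RGet ''eps'' (NConst 0)))
                     (RAdd (RMul (RMul (ROfNat (NConst 12)) (ROfNat (nvar ''r''))) (RGet ''wmax'' (NConst 0)))
                           (RGet ''eps'' (NConst 0))))
         (Seq body (incr ''T'')))"

definition argmin :: com where
  "argmin =
     Seq (nset ''v'' (NConst 0)) (Seq (nset ''u'' (NConst 0))
       (While (NLess (nvar ''u'') (nvar ''n''))
         (Seq (Cond (RLess (RGet ''G'' (NAdd (nvar ''base'') (nvar ''u'')))
                           (RGet ''G'' (NAdd (nvar ''base'') (nvar ''v''))))
                 (nset ''v'' (nvar ''u'')) Skip)
              (incr ''u''))))"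

text \<open>\<open>e\<close> computes the position of the edge to take. \<open>base\<close> goes
  back one row per step, since a cheapest walk reads the table from its last row downwards.\<close>

definition walk :: "nexp \<Rightarrow> com" where
  "walk e =
     Seq (nset ''t'' (NConst 0))
       (While (NLess (nvar ''t'') (nvar ''T''))
         (Seq (nset ''k'' e)
         (Seq (RStore ''P'' (nvar ''k'')
                (RAdd (RGet ''P'' (nvar ''k'')) (RDiv (ROfNat (NConst 1)) (ROfNat (nvar ''T'')))))
         (Seq (nset ''v'' (NGet ''tgt'' (nvar ''k'')))
         (Seq (nset ''base'' (NSub (nvar ''base'') (nvar ''n'')))
              (incr ''t''))))))"

context graph_input
begin

text \<open>The number of passes after which the loop test of \<open>repeat_rounds\<close> fails.
  The walk needs \<open>6 * d * wmax / \<epsilon>\<close> steps, and \<open>d \<le> 2 * r\<close>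
  makes this 12.\<close>

definition rounds :: "nat \<Rightarrow> nat" where
  "rounds r = nat \<lceil>(12 * real r * wmax + \<epsilon>) / \<epsilon>\<rceil>"

lemma less_rounds_iff: "real T * \<epsilon> < 12 * real r * wmax + \<epsilon> \<longleftrightarrow> T < rounds r"
proof -
  have "T < rounds r \<longleftrightarrow> real T < (12 * real r * wmax + \<epsilon>) / \<epsilon>"
    unfolding rounds_def by linarith
  then show ?thesis using eps_pos by (simp add: pos_less_divide_eq)
qed

lemma rounds_ge: "12 * real r * wmax + \<epsilon> \<le> real (rounds r) * \<epsilon>"
  using less_rounds_iff[of "rounds r" r] by simp

lemma rounds_pos: "0 < rounds r"
  using less_rounds_iff[of 0 r] wmax_nonneg eps_pos by (simp add: add_nonneg_pos)

lemma rounds_le: "real (rounds r) \<le> 12 * real r * (wmax / \<epsilon>) + 2"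
proof -
  have "0 \<le> (12 * real r * wmax + \<epsilon>) / \<epsilon>" using wmax_nonneg eps_pos by simp
  then have "real (rounds r) \<le> (12 * real r * wmax + \<epsilon>) / \<epsilon> + 1" unfolding rounds_def by linarith
  also have "\<dots> = 12 * real r * (wmax / \<epsilon>) + 2" using eps_pos by (simp add: add_divide_distrib)
  finally show ?thesis .
qed

text \<open>\<open>c u\<close> is one plus the position of the first edge of a cheapest extension at \<open>u\<close>; 0 means that
  no edge leaving \<open>u\<close> has been seen yet.\<close>

definition relaxed :: "(nat \<Rightarrow> real) \<Rightarrow> (nat \<Rightarrow> real) \<Rightarrow> (nat \<Rightarrow> nat) \<Rightarrow> nat \<Rightarrow> bool" where
  "relaxed g h c k \<longleftrightarrow>
     (\<forall>u<n. 0 < c u \<longrightarrow> c u - 1 < m \<and> src (c u - 1) = u \<and> h u = wt (c u - 1) + g (tgt (c u - 1))) \<and>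
     (\<forall>i<k. 0 < c (src i) \<and> h (src i) \<le> wt i + g (tgt i))"

lemma relaxed_keep:
  "relaxed g h c k \<Longrightarrow> 0 < c (src k) \<Longrightarrow> \<not> wt k + g (tgt k) < h (src k) \<Longrightarrow> relaxed g h c (Suc k)"
  by (auto simp: relaxed_def less_Suc_eq)

text \<open>A marked entry only decreases; at an unmarked one, no earlier edge has the same tail.
  Either way the inequalities of earlier edges survive.\<close>

lemma relaxed_update:
  assumes "relaxed g h c k" "k < m" "0 < c (src k) \<longrightarrow> wt k + g (tgt k) < h (src k)"
  shows "relaxed g (h(src k := wt k + g (tgt k))) (c(src k := Suc k)) (Suc k)"
  using assms by (fastforce simp: relaxed_def less_Suc_eq)

lemma relaxed_cong:
  assumes "k \<le> m" "\<And>u. u < n \<Longrightarrow> g u = g' u" "\<And>u. u < n \<Longrightarrow> h u = h' u" "\<And>u. u < n \<Longrightarrow> c u = c' u"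
  shows "relaxed g h c k \<longleftrightarrow> relaxed g' h' c' k"
  unfolding relaxed_def using assms src_range(1) tgt_less by (auto 0 4)

section \<open>The table as a flat array\<close>

definition row :: "(nat \<Rightarrow> 'a) \<Rightarrow> nat \<Rightarrow> nat \<Rightarrow> 'a" where
  "row f j u = f (j * n + u)"

lemma row_update:
  assumes "u < n" "v < n"
  shows "row (f(i * n + v := y)) j u = (if j = i then ((row f j)(v := y)) u else row f j u)"
proof -
  have "j * n + u = i * n + v \<longleftrightarrow> j = i \<and> u = v"
  proof
    assume *: "j * n + u = i * n + v"
    then have "(j * n + u) div n = (i * n + v) div n" by simp
    with assms have "j = i" by simp
    with * show "j = i \<and> u = v" by simp
  qed simp
  then show ?thesis by (auto simp: row_def)
qed

text \<open>Row \<open>j\<close> of \<open>G\<close> holds \<open>V\<^sub>j\<close>; row \<open>j\<close> of \<open>ch\<close> holds the first edges of walks attaining it.\<close>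

definition table :: "nat \<Rightarrow> (nat \<Rightarrow> real) \<Rightarrow> (nat \<Rightarrow> nat) \<Rightarrow> bool" where
  "table T G ch \<longleftrightarrow> (\<forall>u<n. row G 0 u = 0) \<and>
     (\<forall>j<T. relaxed (row G j) (row G (Suc j)) (row ch (Suc j)) m)"

text \<open>Zeros in \<open>ch\<close> tell the next round which cells of \<open>G\<close> hold no
  value yet.\<close>

definition unused :: "nat \<Rightarrow> (nat \<Rightarrow> nat) \<Rightarrow> bool" where
  "unused T ch \<longleftrightarrow> (\<forall>j>T. \<forall>u<n. row ch j u = 0)"

lemma table_update:
  assumes "table T G ch" "v < n" "i > T"
  shows "table T (G(i * n + v := y)) ch" "table T G (ch(i * n + v := z))"
proof -
  have "relaxed (row (G(i * n + v := y)) j) (row (G(i * n + v := y)) (Suc j)) (row ch (Suc j)) m"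
    if "j < T" for j
  proof -
    have "relaxed (row G j) (row G (Suc j)) (row ch (Suc j)) m" using assms that by (simp add: table_def)
    then show ?thesis
      by (subst relaxed_cong[where g' = "row G j" and h' = "row G (Suc j)" and c' = "row ch (Suc j)"])
        (use assms that in \<open>simp_all add: row_update\<close>)
  qed
  with assms show "table T (G(i * n + v := y)) ch" by (simp add: table_def row_update)
  have "relaxed (row G j) (row G (Suc j)) (row (ch(i * n + v := z)) (Suc j)) m" if "j < T" for j
  proof -
    have "relaxed (row G j) (row G (Suc j)) (row ch (Suc j)) m" using assms that by (simp add: table_def)
    then show ?thesis
      by (subst relaxed_cong[where g' = "row G j" and h' = "row G (Suc j)" and c' = "row ch (Suc j)"])
        (use assms that in \<open>simp_all add: row_update\<close>)
  qed
  with assms show "table T G (ch(i * n + v := z))" by (simp add: table_def)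
qed

definition partial_table :: "nat \<Rightarrow> nat \<Rightarrow> (nat \<Rightarrow> real) \<Rightarrow> (nat \<Rightarrow> nat) \<Rightarrow> bool" where
  "partial_table T k G ch \<longleftrightarrow> table T G ch \<and> unused (Suc T) ch \<and>
     relaxed (row G T) (row G (Suc T)) (row ch (Suc T)) k"

lemma partial_table_0: "table T G ch \<Longrightarrow> unused T ch \<Longrightarrow> partial_table T 0 G ch"
  by (simp add: partial_table_def unused_def relaxed_def)

lemma partial_table_m: "partial_table T m G ch \<Longrightarrow> table (Suc T) G ch \<and> unused (Suc T) ch"
  by (auto simp: partial_table_def table_def less_Suc_eq)

lemma partial_table_keep:
  assumes "partial_table T k G ch" "0 < ch (Suc T * n + src k)"
    "\<not> wt k + G (T * n + tgt k) < G (Suc T * n + src k)"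
  shows "partial_table T (Suc k) G ch"
  using assms by (auto simp: partial_table_def row_def intro!: relaxed_keep)

lemma partial_table_update:
  assumes "partial_table T k G ch" "k < m"
    "0 < ch (Suc T * n + src k) \<longrightarrow> wt k + G (T * n + tgt k) < G (Suc T * n + src k)"
  shows "partial_table T (Suc k) (G(Suc T * n + src k := wt k + G (T * n + tgt k)))
    (ch(Suc T * n + src k := Suc k))"
proof -
  note src = src_range(1)[OF assms(2)]
  have "relaxed (row G T) ((row G (Suc T))(src k := wt k + row G T (tgt k)))
      ((row ch (Suc T))(src k := Suc k)) (Suc k)"
    using assms by (intro relaxed_update) (auto simp: partial_table_def row_def)
  then have "relaxed (row (G(Suc T * n + src k := wt k + G (T * n + tgt k))) T)
      (row (G(Suc T * n + src k := wt k + G (T * n + tgt k))) (Suc T))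
      (row (ch(Suc T * n + src k := Suc k)) (Suc T)) (Suc k)"
    by (subst relaxed_cong[where g' = "row G T" and h' = "(row G (Suc T))(src k := wt k + row G T (tgt k))"
          and c' = "(row ch (Suc T))(src k := Suc k)"])
      (use assms(2) src in \<open>simp_all only: row_update if_True refl fun_upd_apply\<close>, simp_all add: row_def)
  moreover have "unused (Suc T) (ch(Suc T * n + src k := Suc k))"
    using assms(1) src unfolding partial_table_def unused_def by (auto simp only: row_update) auto
  moreover have "table T (G(Suc T * n + src k := wt k + G (T * n + tgt k))) (ch(Suc T * n + src k := Suc k))"
    using assms(1) src by (intro table_update) (auto simp: partial_table_def)
  ultimately show ?thesis by (simp add: partial_table_def)
qed

section \<open>Correctness and cost of the loops\<close>

definition vi_frame :: "state \<Rightarrow> state \<Rightarrow> bool" where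
  "vi_frame s s' \<longleftrightarrow> loaded s' \<and> sourced s' \<and> fst s' ''r'' = fst s ''r'' \<and> snd s' ''P'' = snd s ''P''"

lemma vi_frame_simps [simp]:
  "a \<in> {''k'', ''next'', ''h'', ''ch'', ''base'', ''T'', ''u'', ''v''} \<Longrightarrow>
    vi_frame s (nupd a i x s') \<longleftrightarrow> vi_frame s s'"
  "a \<in> {''x'', ''G''} \<Longrightarrow> vi_frame s (rupd a i y s') \<longleftrightarrow> vi_frame s s'"
  by (auto simp: vi_frame_def)

lemma vi_frameD:
  assumes "vi_frame s s'"
  shows "loaded s'" "sourced s'" "fst s' ''r'' = fst s ''r''" "snd s' ''P'' = snd s ''P''"
  using assms by (auto simp: vi_frame_def)

lemma wp_vi_round:
  assumes fr: "vi_frame s0 s" and base: "fst s ''base'' 0 = T * n"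
    and tab: "table T (snd s ''G'') (fst s ''ch'')" "unused T (fst s ''ch'')"
    and post: "\<And>t s'. t \<le> 150 * m \<Longrightarrow> vi_frame s0 s' \<Longrightarrow> fst s' ''T'' = fst s ''T'' \<Longrightarrow>
      fst s' ''base'' 0 = Suc T * n \<Longrightarrow> table (Suc T) (snd s' ''G'') (fst s' ''ch'') \<Longrightarrow>
      unused (Suc T) (fst s' ''ch'') \<Longrightarrow> Q t s'"
  shows "wp vi_round s Q"
  unfolding vi_round_def
proof (simp, rule wp_While[where K = 80 and \<mu> = "\<lambda>s. m - fst s ''k'' 0" and
    I = "\<lambda>s'. vi_frame s0 s' \<and> fst s' ''T'' = fst s ''T'' \<and> fst s' ''k'' 0 \<le> m \<and>
      fst s' ''base'' 0 = T * n \<and> fst s' ''next'' 0 = Suc T * n \<and>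
      partial_table T (fst s' ''k'' 0) (snd s' ''G'') (fst s' ''ch'')"], goal_cases)
  case (1 s')
  then have fr': "vi_frame s0 s'" by simp
  note [simp] = vi_frameD(1,2)[OF fr']
  define k where "k = fst s' ''k'' 0"
  from 1 have k: "k < m" by (simp add: k_def)
  have part: "partial_table T k (snd s' ''G'') (fst s' ''ch'')" using 1 by (simp add: k_def)
  have nxt: "fst s' ''next'' 0 = Suc T * n" and base': "fst s' ''base'' 0 = T * n" using 1 by simp_all
  show ?case
    using 1 k partial_table_keep[OF part] partial_table_update[OF part k]
    by (simp add: diff_less_mono2 nxt base' del: mult_Suc flip: k_def)
next
  case 2
  then show ?case using fr base partial_table_0[OF tab] vi_frameD(1)[OF fr] by simp
next
  case (3 t s')
  then have fr': "vi_frame s0 s'" by simp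
  note [simp] = vi_frameD(1,2)[OF fr']
  from 3 have "fst s' ''k'' 0 = m" by simp
  with 3 partial_table_m show ?case using m_pos by (simp, intro post) auto
qed

text \<open>The body is either a round of value iteration or empty; an empty body leaves only the
  computation of \<open>T\<close> by counting, as the machine cannot round a quotient.\<close>

lemma wp_repeat_rounds:
  assumes "I 0 s" "loaded s"
    and body: "\<And>T s. I T s \<Longrightarrow> loaded s \<Longrightarrow> fst s ''r'' 0 = r \<Longrightarrow> fst s ''T'' 0 = T \<Longrightarrow>
      wp body s (\<lambda>t s'. t \<le> B \<and> I (Suc T) s' \<and> loaded s' \<and> fst s' ''r'' 0 = r \<and> fst s' ''T'' 0 = T)"
    and I_T: "\<And>T s x. I T (nupd ''T'' 0 x s) \<longleftrightarrow> I T s"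
    and r: "fst s ''r'' 0 = r"
    and post: "\<And>t s'. t \<le> rounds r * (B + 50) + 50 \<Longrightarrow> I (rounds r) s' \<Longrightarrow> loaded s' \<Longrightarrow>
      fst s' ''r'' 0 = r \<Longrightarrow> fst s' ''T'' 0 = rounds r \<Longrightarrow> Q t s'"
  shows "wp (repeat_rounds body) s Q"
  unfolding repeat_rounds_def
proof (simp, rule wp_While[where K = "B + 10" and \<mu> = "\<lambda>s. rounds r - fst s ''T'' 0" and
    I = "\<lambda>s'. I (fst s' ''T'' 0) s' \<and> loaded s' \<and> fst s' ''r'' 0 = r \<and> fst s' ''T'' 0 \<le> rounds r"], goal_cases)
  case (1 s')
  then have "fst s' ''T'' 0 < rounds r" using less_rounds_iff[of "fst s' ''T'' 0" r] by simp
  then show ?case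
    using 1 by (simp, intro wp_mono[OF body]) (auto simp: I_T diff_less_mono2)
next
  case 2
  then show ?case using assms by simp
next
  case (3 t s')
  then have "fst s' ''T'' 0 = rounds r" using less_rounds_iff[of "fst s' ''T'' 0" r] by simp
  with 3 show ?case by (intro post) (auto simp: algebra_simps)
qed

lemma wp_argmin:
  assumes fr: "vi_frame s0 s"
    and post: "\<And>t s'. t \<le> 100 * m \<Longrightarrow> vi_frame s0 s' \<Longrightarrow> unchanged {''u'', ''v''} s s' \<Longrightarrow> snd s' = snd s \<Longrightarrow>
      fst s' ''v'' 0 < n \<Longrightarrow> (\<And>u. u < n \<Longrightarrow>
        snd s ''G'' (fst s ''base'' 0 + fst s' ''v'' 0) \<le> snd s ''G'' (fst s ''base'' 0 + u)) \<Longrightarrow> Q t s'"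
  shows "wp argmin s Q"
  unfolding argmin_def
proof (simp, rule wp_While[where K = 40 and \<mu> = "\<lambda>s. n - fst s ''u'' 0" and
    I = "\<lambda>s'. vi_frame s0 s' \<and> unchanged {''u'', ''v''} s s' \<and> snd s' = snd s \<and> fst s' ''u'' 0 \<le> n \<and>
      fst s' ''v'' 0 < n \<and> (\<forall>u<fst s' ''u'' 0.
        snd s ''G'' (fst s ''base'' 0 + fst s' ''v'' 0) \<le> snd s ''G'' (fst s ''base'' 0 + u))"], goal_cases)
  case (1 s')
  then have fr': "vi_frame s0 s'" and un: "unchanged {''u'', ''v''} s s'" by simp_all
  note [simp] = vi_frameD(1)[OF fr']
  have base: "fst s' ''base'' = fst s ''base''" using unchangedD[OF un] by simp
  from 1 show ?case by (fastforce simp: base less_Suc_eq)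
next
  case 2
  then show ?case using fr n_pos by simp
next
  case (3 t s')
  then have fr': "vi_frame s0 s'" by simp
  note [simp] = vi_frameD(1)[OF fr']
  from 3 show ?case using n_le_m m_pos by (intro post) auto
qed

text \<open>The walk dictated by a rule \<open>f\<close> choosing an edge position from time and
  vertex; it covers both the table walk and the walk that ignores the weights.\<close>

fun visit :: "(nat \<Rightarrow> nat \<Rightarrow> nat) \<Rightarrow> nat \<Rightarrow> nat \<Rightarrow> nat" where
  "visit f v 0 = v"
| "visit f v (Suc t) = tgt (f t (visit f v t))"

lemma wp_walk:
  assumes "loaded s" "snd s ''P'' = (\<lambda>_. 0)" and T: "fst s ''T'' 0 = T" and base: "fst s ''base'' 0 = b"
    and e: "\<And>s' t. t < T \<Longrightarrow> loaded s' \<Longrightarrow> unchanged {''t'', ''k'', ''v'', ''base''} s s' \<Longrightarrow>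
      fst s' ''base'' 0 = b - t * n \<Longrightarrow> nval e s' = f t (fst s' ''v'' 0)"
    and cost: "ncost e \<le> 20"
    and post: "\<And>u s'. u \<le> 100 * T + 10 \<Longrightarrow>
      (\<And>k. snd s' ''P'' k = (\<Sum>t<T. of_bool (f t (visit f (fst s ''v'' 0) t) = k)) / real T) \<Longrightarrow> Q u s'"
  shows "wp (walk e) s Q"
  unfolding walk_def
proof (simp, rule wp_While[where K = 70 and \<mu> = "\<lambda>s. T - fst s ''t'' 0" and
    I = "\<lambda>s'. loaded s' \<and> unchanged {''t'', ''k'', ''v'', ''base''} s s' \<and> fst s' ''t'' 0 \<le> T \<and>
      fst s' ''base'' 0 = b - fst s' ''t'' 0 * n \<and>
      fst s' ''v'' 0 = visit f (fst s ''v'' 0) (fst s' ''t'' 0) \<and>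
      (\<forall>k. snd s' ''P'' k = (\<Sum>t<fst s' ''t'' 0. of_bool (f t (visit f (fst s ''v'' 0) t) = k)) / real T)"],
      goal_cases)
  case (1 s')
  then have un: "unchanged {''t'', ''k'', ''v'', ''base''} s s'" by simp
  have T': "fst s' ''T'' 0 = T" using unchangedD[OF un] T by simp
  from 1 T' have t: "fst s' ''t'' 0 < T" by simp
  have e': "nval e s' = f (fst s' ''t'' 0) (visit f (fst s ''v'' 0) (fst s' ''t'' 0))"
    using e[OF t _ un] 1 by simp
  from 1 t cost show ?case
    by (simp add: e' T' diff_less_mono2 add_divide_distrib add.commute del: sum_of_bool_eq)
next
  case 2
  then show ?case using assms by simp
next
  case (3 t s')
  then have un: "unchanged {''t'', ''k'', ''v'', ''base''} s s'" by simp
  have T': "fst s' ''T'' 0 = T" using unchangedD[OF un] T by simp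
  from 3 T' have "fst s' ''t'' 0 = T" by simp
  with 3 show ?case by (intro post) auto
qed

end

section \<open>The algorithm\<close>

text \<open>The factor 4 serves both branches. If \<open>\<epsilon> \<ge> 4 * wmax\<close>, the
  spread \<open>2 * wmax\<close> of the weights and a penalty of \<open>\<epsilon> / 2\<close> fit
  into \<open>\<epsilon>\<close>. Otherwise \<open>wmax / \<epsilon> > 1 / 4\<close>, so the search
  cost of order \<open>m * d\<close> is within the time bound.\<close>

definition find_circulation :: com where
  "find_circulation =
     Cond (RLess (RGet ''eps'' (NConst 0)) (RMul (ROfNat (NConst 4)) (RGet ''wmax'' (NConst 0))))
       (Seq mark_sources (Seq bfs (Seq (repeat_rounds vi_round) (Seq argmin
         (walk (NSub (NGet ''ch'' (NAdd (nvar ''base'') (nvar ''v''))) (NConst 1)))))))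
       (Seq (nset ''r'' (nvar ''m'')) (Seq (repeat_rounds Skip) (walk (NGet ''off'' (nvar ''v'')))))"

context graph_input
begin

section \<open>From walks to suboptimal solutions\<close>

lemma visit_walk:
  assumes f: "\<And>t v. t < T \<Longrightarrow> v < n \<Longrightarrow> f t v < m \<and> src (f t v) = v" and "v < n"
  shows "t \<le> T \<Longrightarrow> visit f v t < n" and "t < T \<Longrightarrow> (visit f v t, visit f v (Suc t)) \<in> E"
proof -
  show lt: "visit f v t < n" if "t \<le> T" for t
    using that by (induction t) (use \<open>v < n\<close> f tgt_less in auto)
  show "t < T \<Longrightarrow> (visit f v t, visit f v (Suc t)) \<in> E"
    using f[of t "visit f v t"] lt[of t] edge[of "f t (visit f v t)"] by simp
qed

text \<open>The program counts positions, the matrix counts pairs of endpoints; these agree because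
  tail and head determine the position.\<close>

lemma output_walk_matrix:
  assumes f: "\<And>t v. t < T \<Longrightarrow> v < n \<Longrightarrow> f t v < m \<and> src (f t v) = v" and "v < n"
    and P: "\<And>k. snd s ''P'' k = (\<Sum>t<T. of_bool (f t (visit f v t) = k)) / real T"
  shows "output_matrix n s\<^sub>0 s (walk_matrix T (visit f v))"
proof -
  note lt = visit_walk(1)[of T f v, OF f \<open>v < n\<close>]
  show "output_matrix n s\<^sub>0 s (walk_matrix T (visit f v))"
    unfolding output_matrix_def
  proof (intro allI impI ballI)
    fix u k assume u: "u < n" and k: "k \<in> {off u..<off (Suc u)}"
    have src: "src k = u" using src_unique[OF u] k by simp
    have "k < m" using k off_mono[of "Suc u" n] u off_n by simp
    have "visit f v t = u \<and> visit f v (Suc t) = tgt k \<longleftrightarrow> f t (visit f v t) = k" if "t < T" for t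
      using f[of t "visit f v t"] lt[of t] that edge_index_inj[OF \<open>k < m\<close>, of "f t (visit f v t)"] src
      by auto
    then have "(\<Sum>t<T. of_bool (visit f v t = u \<and> visit f v (Suc t) = tgt k)) =
        (\<Sum>t<T. of_bool (f t (visit f v t) = k) :: real)"
      by (intro sum.cong refl arg_cong[where f = of_bool]) simp
    then show "walk_matrix T (visit f v) u (tgt k) = snd s ''P'' k"
      by (simp only: walk_matrix_def P)
  qed
qed

lemma suboptimal_free_walk:
  assumes f: "\<And>t v. t < T \<Longrightarrow> v < n \<Longrightarrow> f t v < m \<and> src (f t v) = v" and v: "v < n"
    and "4 * wmax \<le> \<epsilon>" "0 < T" "12 * real m * wmax \<le> real T * \<epsilon>"
  shows "suboptimal_on \<epsilon> (edge_simplex n E) (penalized_objective n E w wmax) (walk_matrix T (visit f v))"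
proof -
  let ?x = "visit f v"
  have x: "\<And>t. t \<le> T \<Longrightarrow> ?x t < n" "\<And>t. t < T \<Longrightarrow> (?x t, ?x (Suc t)) \<in> E"
    using visit_walk[of T f v] f v by auto
  have "(\<Sum>t<T. w (?x t) (?x (Suc t))) \<le> (\<Sum>t<T. wmax)"
    by (rule sum_mono) (use w_bounded[OF x(2)] in \<open>simp add: abs_le_iff\<close>)
  then have "(\<Sum>t<T. w (?x t) (?x (Suc t))) / real T \<le> wmax"
    using \<open>0 < T\<close> by (simp add: divide_le_eq mult.commute)
  moreover have "6 * real d * wmax / real T \<le> \<epsilon> / 2"
  proof -
    have "12 * real d * wmax \<le> 12 * real m * wmax"
      using hop_diameter_le_card wmax_nonneg by (intro mult_right_mono) auto
    with assms(5) have "12 * real d * wmax \<le> real T * \<epsilon>" by linarith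
    then show ?thesis using \<open>0 < T\<close> by (simp add: divide_le_eq mult.commute)
  qed
  ultimately have up: "penalized_objective n E w wmax (walk_matrix T ?x) \<le> wmax + \<epsilon> / 2"
    using walk_matrix_objective[of T ?x] x \<open>0 < T\<close> by fastforce
  show ?thesis
    unfolding suboptimal_on_def
  proof (intro conjI ballI)
    show "walk_matrix T ?x \<in> edge_simplex n E"
      by (rule walk_matrix_simplex) (use x \<open>0 < T\<close> in auto)
    fix y assume "y \<in> edge_simplex n E"
    then show "penalized_objective n E w wmax (walk_matrix T ?x) \<le> penalized_objective n E w wmax y + \<epsilon>"
      using objective_ge_neg_wmax[of y] up assms(3) by simp
  qed
qed

text \<open>Every vertex has an outgoing edge, so after a full sweep no entry of \<open>ch\<close>
  is 0 and subtracting 1 yields a genuine position.\<close>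

lemma table_edge:
  assumes "table T G ch" "j < T" "u < n"
  shows "ch (Suc j * n + u) - 1 < m" "src (ch (Suc j * n + u) - 1) = u"
    "row G (Suc j) u = wt (ch (Suc j * n + u) - 1) + row G j (tgt (ch (Suc j * n + u) - 1))"
proof -
  have rel: "relaxed (row G j) (row G (Suc j)) (row ch (Suc j)) m" using assms by (simp add: table_def)
  obtain k where "k < m" "src k = u" using edge_from assms by blast
  with rel have "0 < row ch (Suc j) u" by (auto simp: relaxed_def)
  with rel assms(3) show "ch (Suc j * n + u) - 1 < m" "src (ch (Suc j * n + u) - 1) = u"
    "row G (Suc j) u = wt (ch (Suc j * n + u) - 1) + row G j (tgt (ch (Suc j * n + u) - 1))"
    unfolding relaxed_def by (auto simp: row_def)
qed

lemma value_iteration_table: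
  assumes "table T G ch"
  shows "value_iteration n E w wmax (row G) T"
proof unfold_locales
  show "row G 0 u = 0" if "u < n" for u using assms that by (simp add: table_def)
  show "row G (Suc j) u \<le> w u v + row G j v" if "j < T" "(u, v) \<in> E" for j u v
  proof -
    obtain k where "k < m" "src k = u" "tgt k = v" using edge_index \<open>(u, v) \<in> E\<close> by blast
    moreover from this assms \<open>j < T\<close> have "row G (Suc j) (src k) \<le> wt k + row G j (tgt k)"
      unfolding table_def relaxed_def by blast
    ultimately show ?thesis using wt_edge[of k] by simp
  qed
  show "\<exists>v. (u, v) \<in> E \<and> row G (Suc j) u = w u v + row G j v" if "j < T" "u < n" for j u
    using table_edge[OF assms that] edge wt_edge by metis
qed

lemma suboptimal_table_walk:
  assumes tab: "table T G ch" and v: "v < n" "\<And>u. u < n \<Longrightarrow> row G T v \<le> row G T u"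
    and "0 < T" "6 * real d * wmax \<le> real T * \<epsilon>"
    and f_def: "f = (\<lambda>t v. ch ((T - t) * n + v) - 1)"
  shows "suboptimal_on \<epsilon> (edge_simplex n E) (penalized_objective n E w wmax) (walk_matrix T (visit f v))"
    and "\<And>t v. t < T \<Longrightarrow> v < n \<Longrightarrow> f t v < m \<and> src (f t v) = v"
proof -
  interpret value_iteration n E w wmax "row G" T by (rule value_iteration_table[OF tab])
  have step: "f t u < m \<and> src (f t u) = u \<and>
      row G (T - t) u = w u (tgt (f t u)) + row G (T - Suc t) (tgt (f t u))" if "t < T" "u < n" for t u
    using table_edge[OF tab, of "T - Suc t" u] that wt_edge[of "f t u"]
    by (simp add: f_def Suc_diff_Suc)
  then show f: "\<And>t v. t < T \<Longrightarrow> v < n \<Longrightarrow> f t v < m \<and> src (f t v) = v" by blast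
  let ?x = "visit f v"
  have x: "\<And>t. t \<le> T \<Longrightarrow> ?x t < n" "\<And>t. t < T \<Longrightarrow> (?x t, ?x (Suc t)) \<in> E"
    using visit_walk[of T f v] f v by auto
  \<comment> \<open>After \<open>t\<close> steps the walk still has \<open>T - t\<close> edges to
    go, which is the row that \<open>f\<close> consults; at \<open>t = T\<close> the remaining value
    is 0.\<close>
  have "t \<le> T \<Longrightarrow> row G T v = (\<Sum>i<t. w (?x i) (?x (Suc i))) + row G (T - t) (?x t)" for t
  proof (induction t)
    case (Suc t)
    then show ?case using step[of t "?x t"] x(1)[of t] by simp
  qed simp
  from this[of T] have "(\<Sum>i<T. w (?x i) (?x (Suc i))) = row G T v"
    using V_0 x(1)[of T] by simp
  moreover have "6 * real d * wmax / real T \<le> \<epsilon>"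
    using assms(5) \<open>0 < T\<close> by (simp add: divide_le_eq mult.commute)
  ultimately have up: "penalized_objective n E w wmax (walk_matrix T ?x) \<le> row G T v / real T + \<epsilon>"
    using walk_matrix_objective[of T ?x] x \<open>0 < T\<close> by fastforce
  show "suboptimal_on \<epsilon> (edge_simplex n E) (penalized_objective n E w wmax) (walk_matrix T ?x)"
    unfolding suboptimal_on_def
  proof (intro conjI ballI)
    show "walk_matrix T ?x \<in> edge_simplex n E"
      by (rule walk_matrix_simplex) (use x \<open>0 < T\<close> in auto)
    fix y assume "y \<in> edge_simplex n E"
    then show "penalized_objective n E w wmax (walk_matrix T ?x) \<le> penalized_objective n E w wmax y + \<epsilon>"
      using objective_ge_value[of y "row G T v"] up v(2) \<open>0 < T\<close> by fastforce
  qed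
qed

text \<open>For \<open>d = 0\<close> the main term of the time bound vanishes; the graph is then a
  single loop, and the summand 1 pays for it.\<close>

lemma trivial_diameter:
  assumes "d = 0"
  shows "m = 1"
proof -
  have "n = 1" using hop_diameter_pos n_pos assms by (cases "1 < n") auto
  then have "E = {(0, 0)}" using E_subset E_nonempty by auto
  then show ?thesis by simp
qed

section \<open>Assembling the two branches\<close>

definition solved :: "nat \<Rightarrow> state \<Rightarrow> bool" where
  "solved t s \<longleftrightarrow>
     (\<exists>P. output_matrix n s\<^sub>0 s P \<and>
        suboptimal_on \<epsilon> (edge_simplex n E) (penalized_objective n E w wmax) P) \<and>
     real t \<le> 20000 * (1 + real m * real d * wmax / \<epsilon>)"

lemma solved_antimono: "solved u s \<Longrightarrow> t \<le> u \<Longrightarrow> solved t s"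
  by (auto simp: solved_def)

text \<open>The 20 extra operations pay for the test in \<open>find_circulation\<close>.\<close>

lemma wp_free_walk:
  assumes "4 * wmax \<le> \<epsilon>"
  shows "wp (Seq (nset ''r'' (nvar ''m'')) (Seq (repeat_rounds Skip) (walk (NGet ''off'' (nvar ''v'')))))
    s\<^sub>0 (\<lambda>t. solved (t + 20))"
proof (simp, rule wp_repeat_rounds[where B = 1 and r = m and
      I = "\<lambda>_ s. fst s ''v'' 0 = 0 \<and> snd s ''P'' = (\<lambda>_. 0)"], goal_cases)
  case (6 t1 s1)
  let ?T = "rounds m" and ?f = "\<lambda>_ v. off v"
  show ?case
  proof (rule wp_walk[where T = ?T and f = ?f and b = "fst s1 ''base'' 0"], goal_cases)
    case (7 t2 s2)
    have f: "\<And>t v. t < ?T \<Longrightarrow> v < n \<Longrightarrow> ?f t v < m \<and> src (?f t v) = v" using off_row by blast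
    have "12 * real m * wmax \<le> real ?T * \<epsilon>" using rounds_ge[of m] eps_pos by linarith
    note sub = suboptimal_free_walk[OF f n_pos assms rounds_pos this]
    have "output_matrix n s\<^sub>0 s2 (walk_matrix ?T (visit ?f 0))"
      by (rule output_walk_matrix[OF f n_pos]) (use 6 7 in simp_all)
    moreover have "real (t1 + t2 + 40) \<le> 20000 * (1 + real m * real d * wmax / \<epsilon>)"
    proof -
      define X where "X = real m * real d * (wmax / \<epsilon>)"
      define Y where "Y = real m * (wmax / \<epsilon>)"
      have "real (t1 + t2 + 40) \<le> 200 * real ?T + 200" using 6 7 by simp
      moreover have "real ?T \<le> 12 * Y + 2" using rounds_le[of m] by (simp add: Y_def)
      \<comment> \<open>The number of steps was bounded with \<open>m\<close> in place of
        \<open>d\<close>. This fits because either \<open>d \<ge> 1\<close>, or \<open>m = 1\<close>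
        and \<open>wmax / \<epsilon> \<le> 1 / 4\<close>.\<close>
      moreover have "Y \<le> 1 + X"
      proof (cases "d = 0")
        case True
        then show ?thesis
          using trivial_diameter assms eps_pos wmax_nonneg by (simp add: X_def Y_def divide_le_eq)
      next
        case False
        then have "real m * 1 * (wmax / \<epsilon>) \<le> real m * real d * (wmax / \<epsilon>)"
          using wmax_nonneg eps_pos by (intro mult_right_mono mult_left_mono) auto
        then show ?thesis by (simp add: X_def Y_def)
      qed
      moreover have "0 \<le> X" using wmax_nonneg eps_pos by (simp add: X_def)
      moreover have "a \<le> 20000 * (1 + X)"
        if "a \<le> 200 * b + 200" "b \<le> 12 * Y + 2" "Y \<le> 1 + X" "0 \<le> X" for a b
        using that by simp
      ultimately have "real (t1 + t2 + 40) \<le> 20000 * (1 + X)" by blast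
      then show ?thesis by (simp add: X_def)
    qed
    ultimately show ?case unfolding solved_def using sub by (intro conjI exI) auto
  qed (use 6 in auto)
qed (use loaded_s0 blank in auto)

lemma wp_table_walk:
  assumes "\<epsilon> < 4 * wmax"
  shows "wp (Seq mark_sources (Seq bfs (Seq (repeat_rounds vi_round) (Seq argmin
      (walk (NSub (NGet ''ch'' (NAdd (nvar ''base'') (nvar ''v''))) (NConst 1)))))))
    s\<^sub>0 (\<lambda>t. solved (t + 20))"
proof (simp, rule wp_mark_sources, rule loaded_s0, goal_cases)
  case (1 t1 s1)
  note t1 = 1(1) and un1 = unchangedD[OF 1(4)]
  show ?case
  proof (rule wp_bfs, goal_cases)
    case (5 t2 s2)
    then have "loaded s2" "sourced s2" and "unchanged {''v'', ''k'', ''r'', ''fw'', ''bw''} s1 s2"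
      and snd2: "snd s2 = snd s\<^sub>0" using 1 by (simp_all add: bfs_frame_def)
    note un2 = unchangedD[OF this(3)]
    have fr: "vi_frame s2 s2" using \<open>loaded s2\<close> \<open>sourced s2\<close> by (simp add: vi_frame_def)
    have base: "fst s2 ''base'' = (\<lambda>_. 0)" and ch: "fst s2 ''ch'' = (\<lambda>_. 0)"
      using un1 un2 blank(1) by simp_all
    have G: "snd s2 ''G'' = (\<lambda>_. 0)" and P: "snd s2 ''P'' = (\<lambda>_. 0)"
      using snd2 blank(2) by simp_all
    define r where "r = fst s2 ''r'' 0"
    let ?T = "rounds r"
    show ?case
    proof (rule wp_repeat_rounds[where B = "150 * m" and r = r and I = "\<lambda>T s. vi_frame s2 s \<and>
          fst s ''base'' 0 = T * n \<and> table T (snd s ''G'') (fst s ''ch'') \<and> unused T (fst s ''ch'')"],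
        goal_cases)
      case 1
      then show ?case using fr base ch G by (simp add: table_def unused_def row_def)
    next
      case (3 T s)
      show ?case
        by (rule wp_vi_round[of s2 s T]) (use 3 in \<open>auto simp: vi_frame_def\<close>)
    next
      case (6 t3 s3)
      then have fr3: "vi_frame s2 s3" by simp
      show ?case
      proof (rule wp_argmin[OF fr3], goal_cases)
        case (1 t4 s4)
        note un4 = unchangedD[OF 1(3)]
        have base4: "fst s4 ''base'' 0 = ?T * n" and T4: "fst s4 ''T'' 0 = ?T"
          and ch4: "fst s4 ''ch'' = fst s3 ''ch''"
          using un4 6 by simp_all
        let ?v = "fst s4 ''v'' 0"
        define f where "f = (\<lambda>t v. fst s3 ''ch'' ((?T - t) * n + v) - 1)"
        show ?case
        proof (rule wp_walk[where T = ?T and f = f and b = "?T * n"], goal_cases)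
          \<comment> \<open>\<open>base\<close> has gone back \<open>t\<close> rows, so the entry
            read lies in row \<open>?T - t\<close>.\<close>
          case (5 s' t)
          then have "fst s' ''ch'' = fst s3 ''ch''" using unchangedD[OF 5(3)] ch4 by simp
          with 5 show ?case by (simp add: f_def diff_mult_distrib)
        next
          case (7 t5 s5)
          have "12 * real r * wmax \<le> real ?T * \<epsilon>" using rounds_ge[of r] eps_pos by linarith
          moreover have "6 * real d * wmax \<le> 12 * real r * wmax"
            using 5 wmax_nonneg by (intro mult_right_mono) (auto simp: r_def)
          ultimately have T: "6 * real d * wmax \<le> real ?T * \<epsilon>" by linarith
          have tab: "table ?T (snd s3 ''G'') (fst s3 ''ch'')" using 6 by simp
          have min: "row (snd s3 ''G'') ?T ?v \<le> row (snd s3 ''G'') ?T u" if "u < n" for u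
            using 1(6)[OF that] 6 by (simp add: row_def)
          note sub = suboptimal_table_walk[OF tab 1(5) min rounds_pos T f_def]
          have "output_matrix n s\<^sub>0 s5 (walk_matrix ?T (visit f ?v))"
            by (rule output_walk_matrix[OF sub(2) 1(5)]) (use 7 in simp_all)
          moreover have "real (t1 + (t2 + (t3 + (t4 + t5))) + 20) \<le> 20000 * (1 + real m * real d * wmax / \<epsilon>)"
          proof -
            define X where "X = real m * real d * (wmax / \<epsilon>)"
            define Y where "Y = real m * real d"
            define Z where "Z = real m * real ?T"
            \<comment> \<open>Only in this branch is the ratio bounded below; it absorbs the search
              cost \<open>Y\<close> into \<open>X\<close>.\<close>
            have x: "1 / 4 \<le> wmax / \<epsilon>" using assms eps_pos by (simp add: le_divide_eq)
            have "real t1 \<le> 100 * real m" "real t4 \<le> 100 * real m" "real t5 \<le> 100 * real ?T + 10"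
              using 1(1) t1 7(1) by linarith+
            moreover have "real t2 \<le> 300 * Y + 300 * real m"
            proof -
              have "real t2 \<le> real (300 * m * (d + 1))" using 5(1) by (rule of_nat_mono)
              then show ?thesis by (simp add: Y_def algebra_simps)
            qed
            moreover have "real t3 \<le> 150 * Z + 50 * real ?T + 50"
            proof -
              have "real t3 \<le> real (?T * (150 * m + 50) + 50)" using 6(1) by (rule of_nat_mono)
              then show ?thesis by (simp add: Z_def algebra_simps)
            qed
            moreover have "real ?T \<le> Z" using mult_right_mono[of 1 "real m" "real ?T"] m_pos by (simp add: Z_def)
            \<comment> \<open>Here \<open>r \<le> d\<close> converts the number of rounds into a
              bound in \<open>d\<close>.\<close>
            moreover have "Z \<le> 12 * X + 2 * real m"
            proof -
              have "real r * (wmax / \<epsilon>) \<le> real d * (wmax / \<epsilon>)"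
                using 5(3) wmax_nonneg eps_pos by (intro mult_right_mono) (auto simp: r_def)
              then have "real ?T \<le> 12 * (real d * (wmax / \<epsilon>)) + 2" using rounds_le[of r] by simp
              then have "Z \<le> real m * (12 * (real d * (wmax / \<epsilon>)) + 2)"
                unfolding Z_def by (rule mult_left_mono) simp
              also have "\<dots> = 12 * X + 2 * real m" by (simp only: X_def algebra_simps)
              finally show ?thesis .
            qed
            moreover have "Y \<le> 4 * X"
            proof -
              have "Y * (1 / 4) \<le> Y * (wmax / \<epsilon>)" using x by (intro mult_left_mono) (auto simp: Y_def)
              then show ?thesis by (simp add: X_def Y_def mult_ac)
            qed
            moreover have "real m \<le> 1 + Y"
            proof (cases "d = 0")
              case True
              then show ?thesis using trivial_diameter by (simp add: Y_def)
            next
              case False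
              then have "real m * 1 \<le> real m * real d" by (intro mult_left_mono) auto
              then show ?thesis by (simp add: Y_def)
            qed
            moreover have "0 \<le> Y" by (simp add: Y_def)
            moreover have "b1 + (b2 + (b3 + (b4 + b5))) + 20 \<le> 20000 * (1 + X)"
              if "b1 \<le> 100 * c" "b4 \<le> 100 * c" "b5 \<le> 100 * q + 10" "b2 \<le> 300 * Y + 300 * c"
                "b3 \<le> 150 * Z + 50 * q + 50" "q \<le> Z" "Z \<le> 12 * X + 2 * c" "Y \<le> 4 * X"
                "c \<le> 1 + Y" "0 \<le> Y"
              for b1 b2 b3 b4 b5 c q
              using that by simp
            ultimately have "real t1 + (real t2 + (real t3 + (real t4 + real t5))) + 20 \<le> 20000 * (1 + X)"
              by blast
            then show ?thesis by (simp add: X_def)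
          qed
          ultimately show ?case unfolding solved_def using sub by (intro conjI exI) auto
        qed (use 1 6 P T4 base4 in \<open>auto simp: vi_frame_def\<close>)
      qed
    qed (use \<open>loaded s2\<close> in \<open>auto simp: r_def vi_frame_def\<close>)
  qed (use 1 un1 blank(1) in auto)
qed

lemma wp_find_circulation: "wp find_circulation s\<^sub>0 solved"
  unfolding find_circulation_def wp_Cond
proof (split if_split, intro conjI impI, goal_cases)
  case 1
  then have "\<epsilon> < 4 * wmax" by (simp add: loaded_simps(8,9)[OF loaded_s0])
  from wp_table_walk[OF this] show ?case
    by (rule wp_mono) (auto elim!: solved_antimono)
next
  case 2
  then have "4 * wmax \<le> \<epsilon>" by (simp add: loaded_simps(8,9)[OF loaded_s0])
  from wp_free_walk[OF this] show ?case
    by (rule wp_mono) (auto elim!: solved_antimono)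
qed

end

theorem theorem6p3:
  shows "\<exists>(A :: com) (C :: real) (c :: nat).
    \<forall>(n :: nat) (E :: (nat \<times> nat) set) (w :: nat \<Rightarrow> nat \<Rightarrow> real) (wmax :: real) (\<epsilon> :: real) (s :: state).
      E \<subseteq> {..<n} \<times> {..<n} \<and> E \<noteq> {} \<and> strongly_connected n E \<and>
      (\<forall>(i, j)\<in>E. - wmax \<le> w i j \<and> w i j \<le> wmax) \<and> 0 < \<epsilon> \<and>
      input_state n E w wmax \<epsilon> s \<longrightarrow>
      (\<exists>t s' P. runs A s t s' \<and>
         output_matrix n s s' P \<and>
         suboptimal_on \<epsilon> (edge_simplex n E) (penalized_objective n E w wmax) P \<and>
         real t \<le> C * (1 + real (card E) * real (hop_diameter n E) * wmax / \<epsilon>)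
                    * ln (3 + real n + 1 / \<epsilon> + wmax) ^ c)"
proof -
  \<comment> \<open>The exponent \<open>c = 0\<close> suffices: no logarithm arises.\<close>
  have "\<exists>t s' P. runs find_circulation s t s' \<and> output_matrix n s s' P \<and>
      suboptimal_on \<epsilon> (edge_simplex n E) (penalized_objective n E w wmax) P \<and>
      real t \<le> 20000 * (1 + real (card E) * real (hop_diameter n E) * wmax / \<epsilon>)
        * ln (3 + real n + 1 / \<epsilon> + wmax) ^ 0"
    if "E \<subseteq> {..<n} \<times> {..<n} \<and> E \<noteq> {} \<and> strongly_connected n E \<and>
      (\<forall>(i, j)\<in>E. - wmax \<le> w i j \<and> w i j \<le> wmax) \<and> 0 < \<epsilon> \<and> input_state n E w wmax \<epsilon> s"
    for n E w wmax \<epsilon> s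
  proof -
    interpret graph_input n E w wmax \<epsilon> s
      by unfold_locales (use that in \<open>auto simp: abs_le_iff\<close>)
    from wp_find_circulation show ?thesis
      unfolding wp_def solved_def power_0 mult_1_right by blast
  qed
  then show ?thesis by blast
qed

end
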